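(* Let $(N,\gamma)$ be a weak Riemannian manifold. Suppose that for each $x\in N$, the exponential mapping $\exp_x$ is a diffeomorphism between an open (in the manifold topology) neighborhood $U_x$ of $0\in T_xN$ and $N$. Then $(N,d_\gamma)$, where $d_\gamma$ is the Riemannian distance function of $\gamma$, is a metric space.
   Context: A Riemannian metric $\gamma$ on a Hilbert or Fréchet manifold $N$ is a smooth $(0,2)$-tensor inducing a bounded, positive-definite scalar product on each tangent space; it is called strong if the tangent spaces are complete with respect to this scalar product, and weak otherwise. Write $\|v\|_\gamma=\sqrt{\gamma(v,v)}$. The length of a path $\eta$ on $[0,1]$ is $L(\eta)=\int_0^1\|\eta'(s)\|_\gamma\,ds$, and $d_\gamma(x,y)$ is the infimum of the lengths of paths in $N$ from $x$ to $y$; a priori $d_\gamma$ is only a pseudometric. Geodesics are those of the Levi-Civita connection of $\gamma$ (whose existence is understood as part of the existence of the exponential mapping). The exponential mapping $\exp_x$ sends $v\in T_xN$ to $c_v(1)$, where $c_v$ is the geodesic with $c_v(0)=x$, $c_v'(0)=v$. The set $U_x$ is open in the manifold topology, not necessarily in the topology induced by $\gamma$. *)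

theory Defs
  imports "HOL-Analysis.Analysis"
begin

section \<open>Frechet spaces\<close>

text \<open>
  The class carries a chosen complete translation-invariant metric, but the definitions below
  use only the topology it induces. The axioms are spelled out in terms of the class operations;
  the lemmas after the class restate them with the library notions.
\<close>

class frechet_space = real_vector + complete_space +
  assumes dist_translate: "dist (x + z) (y + z) = dist x y"
    and scaleR_continuous_eps:
      "e > 0 \<Longrightarrow> \<exists>d>0. \<forall>b y. \<bar>b - a\<bar> < d \<and> dist y x < d \<longrightarrow> dist (b *\<^sub>R y) (a *\<^sub>R x) < e"
    and locally_convex_eps:
      "e > 0 \<Longrightarrow> \<exists>V. open V \<and> 0 \<in> V \<and> (\<forall>x\<in>V. dist 0 x < e) \<and>
         (\<forall>x\<in>V. \<forall>y\<in>V. \<forall>u\<ge>0. \<forall>v\<ge>0. u + v = 1 \<longrightarrow> u *\<^sub>R x + v *\<^sub>R y \<in> V)"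

lemma frechet_continuous_scaleR:
  "continuous_on UNIV (\<lambda>(a::real, x::'a::frechet_space). a *\<^sub>R x)"
proof (clarsimp simp: continuous_on_iff)
  fix a :: real and x :: 'a and e :: real
  assume "e > 0"
  then obtain d where d: "d > 0" "\<And>b y. \<bar>b - a\<bar> < d \<Longrightarrow> dist y x < d \<Longrightarrow> dist (b *\<^sub>R y) (a *\<^sub>R x) < e"
    using scaleR_continuous_eps[of e a x] by blast
  have "dist (b *\<^sub>R y) (a *\<^sub>R x) < e" if "dist (b, y) (a, x) < d" for b y
    using that dist_fst_le[of "(b, y)" "(a, x)"] dist_snd_le[of "(b, y)" "(a, x)"]
    by (intro d(2)) (auto simp: dist_real_def)
  with d(1) show "\<exists>d>0. \<forall>b y. dist (b, y) (a, x) < d \<longrightarrow> dist (b *\<^sub>R y) (a *\<^sub>R x) < e"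
    by blast
qed

lemma frechet_locally_convex:
  assumes "e > 0"
  shows "\<exists>V. open V \<and> (0::'a::frechet_space) \<in> V \<and> convex V \<and> V \<subseteq> ball 0 e"
proof -
  obtain V :: "'a set" where "open V" "0 \<in> V" "\<forall>x\<in>V. dist 0 x < e"
    "\<forall>x\<in>V. \<forall>y\<in>V. \<forall>u\<ge>0. \<forall>v\<ge>0. u + v = 1 \<longrightarrow> u *\<^sub>R x + v *\<^sub>R y \<in> V"
    using locally_convex_eps[OF assms] by blast
  then show ?thesis
    by (intro exI[of _ V]) (auto simp: convex_def)
qed

text \<open>In particular every real Hilbert space is an admissible model space.\<close>

instance banach \<subseteq> frechet_space
proof
  fix x y z :: 'a and a e :: real
  show "dist (x + z) (y + z) = dist x y"
    by (simp add: dist_norm)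
  assume e: "e > 0"
  have "continuous_on UNIV (\<lambda>p::real \<times> 'a. fst p *\<^sub>R snd p)"
    by (intro continuous_intros)
  then obtain d where d: "d > 0"
    "\<And>q. dist q (a, x) < d \<Longrightarrow> dist (fst q *\<^sub>R snd q) (a *\<^sub>R x) < e"
    using e unfolding continuous_on_iff by (metis UNIV_I fst_conv snd_conv)
  have "dist (b *\<^sub>R w) (a *\<^sub>R x) < e" if "\<bar>b - a\<bar> < d / 2" "dist w x < d / 2" for b w
  proof -
    have "dist (b, w) (a, x) \<le> \<bar>b - a\<bar> + dist w x"
      unfolding dist_Pair_Pair dist_real_def by (rule sqrt_sum_squares_le_sum) auto
    then show ?thesis using d(2)[of "(b, w)"] that by simp
  qed
  then show "\<exists>d>0. \<forall>b y. \<bar>b - a\<bar> < d \<and> dist y x < d \<longrightarrow> dist (b *\<^sub>R y) (a *\<^sub>R x) < e"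
    using d(1) by (intro exI[of _ "d / 2"]) auto
  show "\<exists>V. open V \<and> (0::'a) \<in> V \<and> (\<forall>x\<in>V. dist 0 x < e) \<and>
      (\<forall>x\<in>V. \<forall>y\<in>V. \<forall>u\<ge>0. \<forall>v\<ge>0. u + v = 1 \<longrightarrow> u *\<^sub>R x + v *\<^sub>R y \<in> V)"
    using e convexD[OF convex_ball[of "0::'a" e]] by (intro exI[of _ "ball 0 e"]) auto
qed


section \<open>Differential calculus\<close>

text \<open>
  Directional derivatives are unique limits in a Hausdorff space; \<open>Lim\<close> is unspecified where the
  limit does not exist, so existence is always demanded separately.
\<close>

definition dir_deriv ::
  "('a::{real_vector,topological_space} \<Rightarrow> 'b::{real_vector,t2_space}) \<Rightarrow> 'a \<Rightarrow> 'a \<Rightarrow> 'b" where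
  "dir_deriv f x h = Lim (at 0) (\<lambda>t::real. (f (x + t *\<^sub>R h) - f x) /\<^sub>R t)"

definition has_dir_deriv ::
  "('a::{real_vector,topological_space} \<Rightarrow> 'b::{real_vector,t2_space}) \<Rightarrow> 'a \<Rightarrow> 'a \<Rightarrow> bool" where
  "has_dir_deriv f x h \<longleftrightarrow> (\<exists>l. ((\<lambda>t::real. (f (x + t *\<^sub>R h) - f x) /\<^sub>R t) \<longlongrightarrow> l) (at 0))"

text \<open>
  \<open>iter_deriv n f v x\<close> is \<open>D\<^sup>n f(x){v 0, \<dots>, v (n - 1)}\<close>. Only the first \<open>n\<close> entries of the
  sequence \<open>v\<close> matter.
\<close>

primrec iter_deriv ::
  "nat \<Rightarrow> ('a::{real_vector,topological_space} \<Rightarrow> 'b::{real_vector,t2_space}) \<Rightarrow> (nat \<Rightarrow> 'a) \<Rightarrow> 'a \<Rightarrow> 'b"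
where
  "iter_deriv 0 f v = f"
| "iter_deriv (Suc n) f v = (\<lambda>x. dir_deriv (iter_deriv n f v) x (v n))"

text \<open>
  Smoothness in the sense of Michal--Bastiani and Hamilton: every \<open>D\<^sup>n f\<close> exists and is jointly
  continuous in the base point and the directions. Continuity for the product topology on
  sequences is continuity on \<open>U \<times> E\<^sup>n\<close>. Between Banach spaces this gives the same smooth maps as
  Frechet differentiability.
\<close>

definition smooth_on ::
  "'a::{real_vector,topological_space} set \<Rightarrow> ('a \<Rightarrow> 'b::{real_vector,t2_space}) \<Rightarrow> bool" where
  "smooth_on U f \<longleftrightarrow> open U \<and>
     (\<forall>n. (\<forall>v. \<forall>x\<in>U. has_dir_deriv (iter_deriv n f v) x (v n)) \<and>
          continuous_on (U \<times> UNIV) (\<lambda>(x, v). iter_deriv n f v x))"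

definition curve_deriv :: "(real \<Rightarrow> 'b::{real_vector,t2_space}) \<Rightarrow> real set \<Rightarrow> real \<Rightarrow> 'b" where
  "curve_deriv c S t = Lim (at t within S) (\<lambda>s. (c s - c t) /\<^sub>R (s - t))"

definition has_curve_deriv ::
  "(real \<Rightarrow> 'b::{real_vector,t2_space}) \<Rightarrow> real set \<Rightarrow> real \<Rightarrow> 'b \<Rightarrow> bool" where
  "has_curve_deriv c S t l \<longleftrightarrow> ((\<lambda>s. (c s - c t) /\<^sub>R (s - t)) \<longlongrightarrow> l) (at t within S)"


section \<open>Manifolds\<close>

text \<open>The map \<open>coord \<phi>\<close> is meaningful only on \<open>chart_dom \<phi>\<close>.\<close>

datatype ('m, 'e) chart = Chart (chart_dom: "'m set") (coord: "'m \<Rightarrow> 'e")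

definition chart_im :: "('m, 'e) chart \<Rightarrow> 'e set" where
  "chart_im \<phi> = coord \<phi> ` chart_dom \<phi>"

definition chart_inv :: "('m, 'e) chart \<Rightarrow> 'e \<Rightarrow> 'm" where
  "chart_inv \<phi> = inv_into (chart_dom \<phi>) (coord \<phi>)"

definition transition :: "('m, 'e) chart \<Rightarrow> ('m, 'e) chart \<Rightarrow> 'e \<Rightarrow> 'e" where
  "transition \<phi> \<psi> = coord \<psi> \<circ> chart_inv \<phi>"

definition smooth_atlas :: "('m::t2_space, 'e::frechet_space) chart set \<Rightarrow> bool" where
  "smooth_atlas A \<longleftrightarrow>
     (\<forall>\<phi>\<in>A. open (chart_dom \<phi>) \<and> open (chart_im \<phi>) \<and>
        homeomorphism (chart_dom \<phi>) (chart_im \<phi>) (coord \<phi>) (chart_inv \<phi>)) \<and>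
     (\<Union>\<phi>\<in>A. chart_dom \<phi>) = UNIV \<and>
     (\<forall>\<phi>\<in>A. \<forall>\<psi>\<in>A. smooth_on (coord \<phi> ` (chart_dom \<phi> \<inter> chart_dom \<psi>)) (transition \<phi> \<psi>))"


section \<open>Tangent vectors\<close>

text \<open>
  A tangent vector at \<open>x\<close> is the compatible family of its coordinate representations in the charts
  around \<open>x\<close> (and is \<open>0\<close> at all other charts, which makes equality of tangent vectors equality of
  functions). The vector space operations are pointwise; the zero vector is \<open>\<lambda>_. 0\<close>.
\<close>

type_synonym ('m, 'e) tangent = "('m, 'e) chart \<Rightarrow> 'e"

definition tangent_space ::
  "('m::t2_space, 'e::frechet_space) chart set \<Rightarrow> 'm \<Rightarrow> ('m, 'e) tangent set" where
  "tangent_space A x = {\<xi>.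
     (\<forall>\<phi>\<in>A. \<forall>\<psi>\<in>A. x \<in> chart_dom \<phi> \<inter> chart_dom \<psi> \<longrightarrow>
        \<xi> \<psi> = dir_deriv (transition \<phi> \<psi>) (coord \<phi> x) (\<xi> \<phi>)) \<and>
     (\<forall>\<phi>. \<not> (\<phi> \<in> A \<and> x \<in> chart_dom \<phi>) \<longrightarrow> \<xi> \<phi> = 0)}"

text \<open>The tangent vector at \<open>x\<close> with representation \<open>u\<close> in the chart \<open>\<phi>\<close>.\<close>

definition tangent_of ::
  "('m::t2_space, 'e::frechet_space) chart set \<Rightarrow> ('m, 'e) chart \<Rightarrow> 'm \<Rightarrow> 'e \<Rightarrow> ('m, 'e) tangent" where
  "tangent_of A \<phi> x u =
     (\<lambda>\<psi>. if \<psi> \<in> A \<and> x \<in> chart_dom \<psi> then dir_deriv (transition \<phi> \<psi>) (coord \<phi> x) u else 0)"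

text \<open>The manifold topology of \<open>T\<^sub>x N\<close> is the one transported from the model space by a chart.\<close>

definition open_in_tangent_space ::
  "('m::t2_space, 'e::frechet_space) chart set \<Rightarrow> 'm \<Rightarrow> ('m, 'e) tangent set \<Rightarrow> bool" where
  "open_in_tangent_space A x U \<longleftrightarrow> U \<subseteq> tangent_space A x \<and>
     (\<forall>\<phi>\<in>A. x \<in> chart_dom \<phi> \<longrightarrow> open ((\<lambda>\<xi>. \<xi> \<phi>) ` U))"


section \<open>Curves\<close>

definition C1_curve_on ::
  "('m::t2_space, 'e::frechet_space) chart set \<Rightarrow> real set \<Rightarrow> (real \<Rightarrow> 'm) \<Rightarrow> bool" where
  "C1_curve_on A S c \<longleftrightarrow> continuous_on S c \<and>
     (\<forall>\<phi>\<in>A.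
        (\<forall>t\<in>S. c t \<in> chart_dom \<phi> \<longrightarrow>
           has_curve_deriv (coord \<phi> \<circ> c) S t (curve_deriv (coord \<phi> \<circ> c) S t)) \<and>
        continuous_on {t \<in> S. c t \<in> chart_dom \<phi>} (curve_deriv (coord \<phi> \<circ> c) S))"

definition piecewise_C1_path ::
  "('m::t2_space, 'e::frechet_space) chart set \<Rightarrow> (real \<Rightarrow> 'm) \<Rightarrow> bool" where
  "piecewise_C1_path A \<eta> \<longleftrightarrow>
     (\<exists>n (\<tau>::nat \<Rightarrow> real). \<tau> 0 = 0 \<and> \<tau> n = 1 \<and>
        (\<forall>i<n. \<tau> i < \<tau> (Suc i) \<and> C1_curve_on A {\<tau> i..\<tau> (Suc i)} \<eta>))"

definition velocity ::
  "('m::t2_space, 'e::frechet_space) chart set \<Rightarrow> real set \<Rightarrow> (real \<Rightarrow> 'm) \<Rightarrow> real \<Rightarrow> ('m, 'e) tangent"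
where
  "velocity A S c t =
     (\<lambda>\<phi>. if \<phi> \<in> A \<and> c t \<in> chart_dom \<phi> then curve_deriv (coord \<phi> \<circ> c) S t else 0)"


section \<open>Riemannian metrics\<close>

type_synonym ('m, 'e) tensor2 = "'m \<Rightarrow> ('m, 'e) tangent \<Rightarrow> ('m, 'e) tangent \<Rightarrow> real"

definition local_rep ::
  "('m::t2_space, 'e::frechet_space) chart set \<Rightarrow> ('m, 'e) tensor2 \<Rightarrow> ('m, 'e) chart \<Rightarrow>
     'e \<Rightarrow> 'e \<Rightarrow> 'e \<Rightarrow> real" where
  "local_rep A \<gamma> \<phi> p u v =
     \<gamma> (chart_inv \<phi> p) (tangent_of A \<phi> (chart_inv \<phi> p) u) (tangent_of A \<phi> (chart_inv \<phi> p) v)"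

definition smooth_tensor2 ::
  "('m::t2_space, 'e::frechet_space) chart set \<Rightarrow> ('m, 'e) tensor2 \<Rightarrow> bool" where
  "smooth_tensor2 A \<gamma> \<longleftrightarrow>
     (\<forall>\<phi>\<in>A. (\<forall>p\<in>chart_im \<phi>. bilinear (local_rep A \<gamma> \<phi> p)) \<and>
        smooth_on (chart_im \<phi> \<times> UNIV \<times> UNIV) (\<lambda>(p, u, v). local_rep A \<gamma> \<phi> p u v))"

definition riemannian_metric ::
  "('m::t2_space, 'e::frechet_space) chart set \<Rightarrow> ('m, 'e) tensor2 \<Rightarrow> bool" where
  "riemannian_metric A \<gamma> \<longleftrightarrow> smooth_tensor2 A \<gamma> \<and>
     (\<forall>\<phi>\<in>A. \<forall>p\<in>chart_im \<phi>. continuous_on UNIV (\<lambda>(u, v). local_rep A \<gamma> \<phi> p u v)) \<and>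
     (\<forall>x. \<forall>\<xi>\<in>tangent_space A x. \<forall>\<zeta>\<in>tangent_space A x. \<gamma> x \<xi> \<zeta> = \<gamma> x \<zeta> \<xi>) \<and>
     (\<forall>x. \<forall>\<xi>\<in>tangent_space A x. \<xi> \<noteq> (\<lambda>_. 0) \<longrightarrow> \<gamma> x \<xi> \<xi> > 0)"

definition riem_norm :: "('m, 'e) tensor2 \<Rightarrow> 'm \<Rightarrow> ('m, 'e) tangent \<Rightarrow> real" where
  "riem_norm \<gamma> x \<xi> = sqrt (\<gamma> x \<xi> \<xi>)"

definition tangent_complete ::
  "('m::t2_space, 'e::frechet_space) chart set \<Rightarrow> ('m, 'e) tensor2 \<Rightarrow> 'm \<Rightarrow> bool" where
  "tangent_complete A \<gamma> x \<longleftrightarrow>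
     (\<forall>X::nat \<Rightarrow> ('m, 'e) tangent. range X \<subseteq> tangent_space A x \<longrightarrow>
        (\<forall>e>0. \<exists>M. \<forall>m\<ge>M. \<forall>n\<ge>M. riem_norm \<gamma> x (\<lambda>\<phi>. X m \<phi> - X n \<phi>) < e) \<longrightarrow>
        (\<exists>\<xi>\<in>tangent_space A x. (\<lambda>n. riem_norm \<gamma> x (\<lambda>\<phi>. X n \<phi> - \<xi> \<phi>)) \<longlonglongrightarrow> 0))"

definition strong_riemannian_metric ::
  "('m::t2_space, 'e::frechet_space) chart set \<Rightarrow> ('m, 'e) tensor2 \<Rightarrow> bool" where
  "strong_riemannian_metric A \<gamma> \<longleftrightarrow> riemannian_metric A \<gamma> \<and> (\<forall>x. tangent_complete A \<gamma> x)"

definition weak_riemannian_metric ::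
  "('m::t2_space, 'e::frechet_space) chart set \<Rightarrow> ('m, 'e) tensor2 \<Rightarrow> bool" where
  "weak_riemannian_metric A \<gamma> \<longleftrightarrow> riemannian_metric A \<gamma> \<and> \<not> strong_riemannian_metric A \<gamma>"

text \<open>
  At the finitely many breakpoints of a piecewise \<open>C\<^sup>1\<close> path the velocity may be unspecified; this
  does not affect the integral.
\<close>

definition path_length ::
  "('m::t2_space, 'e::frechet_space) chart set \<Rightarrow> ('m, 'e) tensor2 \<Rightarrow> (real \<Rightarrow> 'm) \<Rightarrow> real" where
  "path_length A \<gamma> \<eta> = integral {0..1} (\<lambda>s. riem_norm \<gamma> (\<eta> s) (velocity A {0..1} \<eta> s))"

text \<open>The infimum over the empty set is \<open>\<infinity>\<close>, for points not joined by any path.\<close>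

definition riem_dist ::
  "('m::t2_space, 'e::frechet_space) chart set \<Rightarrow> ('m, 'e) tensor2 \<Rightarrow> 'm \<Rightarrow> 'm \<Rightarrow> ennreal" where
  "riem_dist A \<gamma> x y =
     (INF \<eta>\<in>{\<eta>. piecewise_C1_path A \<eta> \<and> \<eta> 0 = x \<and> \<eta> 1 = y}. ennreal (path_length A \<gamma> \<eta>))"


section \<open>The Levi-Civita connection and the exponential mapping\<close>

text \<open>
  A connection on the tangent bundle is given by its Christoffel maps: in the chart \<open>\<phi>\<close>, for vector
  fields represented by \<open>X\<close> and \<open>Y\<close>, \<open>(\<nabla>\<^sub>X Y)(p) = DY(p){X p} + \<Gamma> \<phi> p (X p) (Y p)\<close>. The
  transformation law under \<open>\<tau> = transition \<phi> \<psi>\<close> states that \<open>\<nabla>\<^sub>X Y\<close> is independent of the chart.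
\<close>

type_synonym ('m, 'e) christoffel = "('m, 'e) chart \<Rightarrow> 'e \<Rightarrow> 'e \<Rightarrow> 'e \<Rightarrow> 'e"

definition connection ::
  "('m::t2_space, 'e::frechet_space) chart set \<Rightarrow> ('m, 'e) christoffel \<Rightarrow> bool" where
  "connection A \<Gamma> \<longleftrightarrow>
     (\<forall>\<phi>\<in>A. (\<forall>p\<in>chart_im \<phi>. bilinear (\<Gamma> \<phi> p)) \<and>
        smooth_on (chart_im \<phi> \<times> UNIV \<times> UNIV) (\<lambda>(p, u, v). \<Gamma> \<phi> p u v)) \<and>
     (\<forall>\<phi>\<in>A. \<forall>\<psi>\<in>A. \<forall>p\<in>coord \<phi> ` (chart_dom \<phi> \<inter> chart_dom \<psi>). \<forall>u v.
        let \<tau> = transition \<phi> \<psi> in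
        \<Gamma> \<psi> (\<tau> p) (dir_deriv \<tau> p u) (dir_deriv \<tau> p v) =
          dir_deriv \<tau> p (\<Gamma> \<phi> p u v) - dir_deriv (\<lambda>q. dir_deriv \<tau> q v) p u)"

definition torsion_free ::
  "('m::t2_space, 'e::frechet_space) chart set \<Rightarrow> ('m, 'e) christoffel \<Rightarrow> bool" where
  "torsion_free A \<Gamma> \<longleftrightarrow> (\<forall>\<phi>\<in>A. \<forall>p\<in>chart_im \<phi>. \<forall>u v. \<Gamma> \<phi> p u v = \<Gamma> \<phi> p v u)"

text \<open>
  \<open>X(\<gamma>(Y, Z)) = \<gamma>(\<nabla>\<^sub>X Y, Z) + \<gamma>(Y, \<nabla>\<^sub>X Z)\<close>, tested on fields \<open>Y = v\<close>, \<open>Z = w\<close> constant in the chart.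
\<close>

definition metric_compatible ::
  "('m::t2_space, 'e::frechet_space) chart set \<Rightarrow> ('m, 'e) tensor2 \<Rightarrow> ('m, 'e) christoffel \<Rightarrow> bool" where
  "metric_compatible A \<gamma> \<Gamma> \<longleftrightarrow>
     (\<forall>\<phi>\<in>A. \<forall>p\<in>chart_im \<phi>. \<forall>u v w.
        dir_deriv (\<lambda>q. local_rep A \<gamma> \<phi> q v w) p u =
          local_rep A \<gamma> \<phi> p (\<Gamma> \<phi> p u v) w + local_rep A \<gamma> \<phi> p v (\<Gamma> \<phi> p u w))"

definition levi_civita ::
  "('m::t2_space, 'e::frechet_space) chart set \<Rightarrow> ('m, 'e) tensor2 \<Rightarrow> ('m, 'e) christoffel \<Rightarrow> bool" where
  "levi_civita A \<gamma> \<Gamma> \<longleftrightarrow> connection A \<Gamma> \<and> torsion_free A \<Gamma> \<and> metric_compatible A \<gamma> \<Gamma>"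

definition geodesic_on ::
  "('m::t2_space, 'e::frechet_space) chart set \<Rightarrow> ('m, 'e) christoffel \<Rightarrow> real set \<Rightarrow> (real \<Rightarrow> 'm) \<Rightarrow> bool"
where
  "geodesic_on A \<Gamma> S c \<longleftrightarrow> C1_curve_on A S c \<and>
     (\<forall>\<phi>\<in>A. \<forall>t\<in>S. c t \<in> chart_dom \<phi> \<longrightarrow>
        (let c' = curve_deriv (coord \<phi> \<circ> c) S
         in has_curve_deriv c' S t (- \<Gamma> \<phi> (coord \<phi> (c t)) (c' t) (c' t))))"

definition geodesic_from ::
  "('m::t2_space, 'e::frechet_space) chart set \<Rightarrow> ('m, 'e) christoffel \<Rightarrow> 'm \<Rightarrow> ('m, 'e) tangent \<Rightarrow>
     (real \<Rightarrow> 'm) \<Rightarrow> bool" where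
  "geodesic_from A \<Gamma> x \<xi> c \<longleftrightarrow>
     geodesic_on A \<Gamma> {0..1} c \<and> c 0 = x \<and> velocity A {0..1} c 0 = \<xi>"

text \<open>
  The geodesic equation on a Frechet manifold need be neither solvable nor uniquely solvable, so
  the exponential mapping is a partial map, defined where there is exactly one geodesic on \<open>[0, 1]\<close>.
\<close>

definition exp_domain ::
  "('m::t2_space, 'e::frechet_space) chart set \<Rightarrow> ('m, 'e) christoffel \<Rightarrow> 'm \<Rightarrow> ('m, 'e) tangent set"
where
  "exp_domain A \<Gamma> x = {\<xi> \<in> tangent_space A x. (\<exists>c. geodesic_from A \<Gamma> x \<xi> c) \<and>
     (\<forall>c c'. geodesic_from A \<Gamma> x \<xi> c \<and> geodesic_from A \<Gamma> x \<xi> c' \<longrightarrow> (\<forall>t\<in>{0..1}. c t = c' t))}"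

definition exp_map ::
  "('m::t2_space, 'e::frechet_space) chart set \<Rightarrow> ('m, 'e) christoffel \<Rightarrow> 'm \<Rightarrow> ('m, 'e) tangent \<Rightarrow> 'm"
where
  "exp_map A \<Gamma> x \<xi> = (THE y. \<exists>c. geodesic_from A \<Gamma> x \<xi> c \<and> c 1 = y)"

text \<open>
  \<open>f\<close> is a diffeomorphism from the open set \<open>U \<subseteq> T\<^sub>x N\<close> onto \<open>N\<close>; smoothness of \<open>f\<close> and of its inverse
  is expressed in the linear coordinate \<open>\<xi> \<mapsto> \<xi> \<phi>\<close> on \<open>T\<^sub>x N\<close> and the charts \<open>\<psi>\<close> of \<open>N\<close>.
\<close>

definition tangent_diffeo ::
  "('m::t2_space, 'e::frechet_space) chart set \<Rightarrow> 'm \<Rightarrow> ('m, 'e) tangent set \<Rightarrow>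
     (('m, 'e) tangent \<Rightarrow> 'm) \<Rightarrow> bool" where
  "tangent_diffeo A x U f \<longleftrightarrow> open_in_tangent_space A x U \<and> bij_betw f U UNIV \<and>
     (\<forall>\<phi>\<in>A. x \<in> chart_dom \<phi> \<longrightarrow>
        (let U' = (\<lambda>\<xi>. \<xi> \<phi>) ` U; f' = (\<lambda>u. f (tangent_of A \<phi> x u))
         in continuous_on U' f' \<and>
            (\<forall>\<psi>\<in>A. smooth_on (U' \<inter> f' -` chart_dom \<psi>) (coord \<psi> \<circ> f') \<and>
                   smooth_on (chart_im \<psi>) (\<lambda>p. inv_into U f (chart_inv \<psi> p) \<phi>))))"

end

(*
  Let V be the inverse of exp_x. For a geodesic c with initial velocity u in U_x, the continuous
  curve V o c stays in U_x and agrees with t u as long as t u lies in U_x; hence t u never leaves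
  U_x, which is therefore star-shaped. So exp_x is smooth along all rays, and the classical Gauss
  lemma holds. With Cauchy-Schwarz it shows that r_x = |V|_gamma is 1-Lipschitz with respect to
  the length of paths. As the radial geodesic from x to y has length r_x(y) and r_x(x) = 0, this
  gives d(x, y) = r_x(y), which is positive for y different from x. Symmetry and the triangle
  inequality follow from the Lipschitz property of r_x along radial geodesics from y, so that no
  paths have to be reversed or concatenated.

  In a Frechet space the geodesic equation has no existence and uniqueness theory, but none is
  needed: everything is deduced from exp_x being a diffeomorphism.
*)

theory Submission
  imports Defs
begin

section \<open>Calculus in Frechet spaces\<close>

text \<open>For a weak metric the manifold topology is finer than the one of the scalar products, so
  a neighbourhood of \<open>x\<close> need not contain any small ball of the distance, and a path
  could leave a normal neighbourhood after arbitrarily little length. This is how such distances can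
  degenerate in infinite dimension. Here the inverse of the exponential mapping is defined on all of
  N, so the radius can be followed along every competing path and no path escapes. Derivatives are
  only directional, and the model space has no norm by which remainders could be estimated. The
  calculus below therefore rests on difference quotients with moving base point and direction,
  confined to convex open sets of values. Rays and paths may cross many charts. Derivatives are
  computed in one chart at a time, but always for a scalar function that does not depend on the
  chart, so that a derivative vanishing at every parameter gives a statement on the whole
  interval.\<close>

lemma frechet_dist_diff: "dist x y = dist (x - y) (0::'a::frechet_space)"
  using dist_translate[of "x - y" y 0] by simp

text \<open>Translation invariance bounds the distance of two sums by the sum of the distances and
  makes negation an isometry. The instance gives access to the limit rules for sums and
  differences.\<close>

instance frechet_space \<subseteq> topological_ab_group_add
proof
  fix a b :: 'a
  have add: "dist (x + y) (a + b) \<le> dist x a + dist y b" for x y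
  proof -
    have "dist (x + y) (a + b) \<le> dist (x + y) (a + y) + dist (a + y) (a + b)"
      by (rule dist_triangle)
    then show ?thesis
      using dist_translate[of x y a] dist_translate[of y a b] by (simp add: add.commute)
  qed
  have lim: "((\<lambda>p. dist (fst p) a + dist (snd p) b) \<longlongrightarrow> dist a a + dist b b) (nhds (a, b))"
    using tendsto_fst[OF filterlim_ident, of "(a, b)"] tendsto_snd[OF filterlim_ident, of "(a, b)"]
    by (intro tendsto_intros) auto
  have "((\<lambda>p. dist (fst p + snd p) (a + b)) \<longlongrightarrow> 0) (nhds (a, b))"
  proof (rule tendsto_sandwich[OF _ _ tendsto_const])
    show "((\<lambda>p. dist (fst p) a + dist (snd p) b) \<longlongrightarrow> 0) (nhds (a, b))"
      using lim by simp
  qed (auto simp: add)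
  then show "((\<lambda>x. fst x + snd x) \<longlongrightarrow> a + b) (nhds a \<times>\<^sub>F nhds b)"
    unfolding nhds_prod[symmetric] by (subst tendsto_dist_iff)
  have neg: "dist (- x) (- a) = dist x a" for x
    using dist_translate[of "- x" "x + a" "- a"] by (simp add: dist_commute algebra_simps)
  have "((\<lambda>x. dist x a) \<longlongrightarrow> dist a a) (nhds a)"
    by (intro tendsto_intros filterlim_ident)
  then show "(uminus \<longlongrightarrow> - a) (nhds a)"
    by (subst tendsto_dist_iff) (simp add: neg)
qed

lemma tendsto_scaleR_frechet:
  fixes g :: "'b \<Rightarrow> 'a::frechet_space"
  assumes "(f \<longlongrightarrow> a) F" "(g \<longlongrightarrow> x) F"
  shows "((\<lambda>t. f t *\<^sub>R g t) \<longlongrightarrow> a *\<^sub>R x) F"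
proof -
  have "isCont (\<lambda>(a::real, x::'a). a *\<^sub>R x) (a, x)"
    using frechet_continuous_scaleR[where 'a='a] by (simp add: continuous_on_eq_continuous_at)
  from isCont_tendsto_compose[OF this tendsto_Pair[OF assms]] show ?thesis by simp
qed

lemma tendsto_along_line:
  fixes x h :: "'a::frechet_space"
  shows "((\<lambda>t. x + t *\<^sub>R h) \<longlongrightarrow> x) (at 0 within S)"
proof -
  have "((\<lambda>t. x + t *\<^sub>R h) \<longlongrightarrow> x + 0 *\<^sub>R h) (at 0 within S)"
    by (intro tendsto_add tendsto_scaleR_frechet tendsto_const tendsto_ident_at)
  then show ?thesis by simp
qed

text \<open>Local convexity at 0, carried to \<open>x\<close> by a translation. Convex open sets of
  slopes take the place of norm estimates in the limit arguments below.\<close>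

lemma frechet_convex_nhd:
  fixes x :: "'a::frechet_space"
  assumes "open S" "x \<in> S"
  obtains C where "open C" "convex C" "x \<in> C" "C \<subseteq> S"
proof -
  obtain e where e: "e > 0" "ball x e \<subseteq> S"
    using assms open_contains_ball by blast
  obtain V :: "'a set" where V: "open V" "0 \<in> V" "convex V" "V \<subseteq> ball 0 e"
    using frechet_locally_convex[OF e(1)] by blast
  let ?C = "(\<lambda>y. y - x) -` V"
  have "continuous_on UNIV (\<lambda>y. y + (- x))"
    by (simp only: continuous_on_def) (intro ballI tendsto_intros)
  then have "open ?C"
    using V(1) by (auto intro!: continuous_open_vimage simp: continuous_on_eq_continuous_at)
  moreover have "convex ?C"
  proof (rule convexI)
    fix y z u v assume yz: "y \<in> ?C" "z \<in> ?C" and uv: "(0::real) \<le> u" "0 \<le> v" "u + v = 1"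
    have "u *\<^sub>R y + v *\<^sub>R z - x = u *\<^sub>R y + v *\<^sub>R z - (u + v) *\<^sub>R x"
      using uv by simp
    also have "\<dots> = u *\<^sub>R (y - x) + v *\<^sub>R (z - x)"
      by (simp only: algebra_simps)
    finally show "u *\<^sub>R y + v *\<^sub>R z \<in> ?C"
      using convexD[OF V(3)] yz uv by auto
  qed
  moreover have "?C \<subseteq> S"
    using V(4) e(2) by (auto simp: subset_iff dist_commute frechet_dist_diff[of _ x])
  ultimately show thesis
    using that V(2) by simp
qed

section \<open>Products of Frechet spaces\<close>

instance prod :: (topological_monoid_add, topological_monoid_add) topological_monoid_add
proof
  fix a b :: "'a \<times> 'b"
  have ab: "(fst \<longlongrightarrow> a) (nhds (a, b))" "(snd \<longlongrightarrow> b) (nhds (a, b))"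
    using tendsto_fst[OF filterlim_ident, of "(a, b)"] tendsto_snd[OF filterlim_ident, of "(a, b)"] by auto
  have "((\<lambda>x. (fst (fst x) + fst (snd x), snd (fst x) + snd (snd x)))
      \<longlongrightarrow> (fst a + fst b, snd a + snd b)) (nhds (a, b))"
    by (intro tendsto_Pair tendsto_add tendsto_fst tendsto_snd ab)
  then show "((\<lambda>x. fst x + snd x) \<longlongrightarrow> a + b) (nhds a \<times>\<^sub>F nhds b)"
    by (simp add: plus_prod_def nhds_prod)
qed

instance prod :: (topological_comm_monoid_add, topological_comm_monoid_add) topological_comm_monoid_add ..

instance prod :: (topological_group_add, topological_group_add) topological_group_add
proof
  fix a :: "'a \<times> 'b"
  have "((\<lambda>x. (- fst x, - snd x)) \<longlongrightarrow> (- fst a, - snd a)) (nhds a)"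
    by (intro tendsto_Pair tendsto_minus tendsto_fst tendsto_snd filterlim_ident)
  then show "(uminus \<longlongrightarrow> - a) (nhds a)"
    by (simp add: uminus_prod_def[abs_def])
qed

instance prod :: (topological_ab_group_add, topological_ab_group_add) topological_ab_group_add ..

text \<open>The local representation of the metric is a smooth function on a product of three copies
  of the model space; through this instance the calculus applies to it.\<close>

instance prod :: (frechet_space, frechet_space) frechet_space
proof
  fix x y z :: "'a \<times> 'b" and a e :: real
  show "dist (x + z) (y + z) = dist x y"
    by (simp add: dist_prod_def dist_translate)
  have le: "dist p q \<le> dist (fst p) (fst q) + dist (snd p) (snd q)" for p q :: "'a \<times> 'b"
    unfolding dist_prod_def by (rule sqrt_sum_squares_le_sum) auto
  assume "e > 0"
  then have e: "e / 2 > 0" by simp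
  obtain d1 where d1: "d1 > 0" "\<And>b y. \<bar>b - a\<bar> < d1 \<Longrightarrow> dist y (fst x) < d1 \<Longrightarrow> dist (b *\<^sub>R y) (a *\<^sub>R fst x) < e / 2"
    using scaleR_continuous_eps[OF e, of a "fst x"] by blast
  obtain d2 where d2: "d2 > 0" "\<And>b y. \<bar>b - a\<bar> < d2 \<Longrightarrow> dist y (snd x) < d2 \<Longrightarrow> dist (b *\<^sub>R y) (a *\<^sub>R snd x) < e / 2"
    using scaleR_continuous_eps[OF e, of a "snd x"] by blast
  have "dist (b *\<^sub>R y) (a *\<^sub>R x) < e" if "\<bar>b - a\<bar> < min d1 d2" "dist y x < min d1 d2" for b y
    using le[of "b *\<^sub>R y" "a *\<^sub>R x"] d1(2)[of b "fst y"] d2(2)[of b "snd y"] that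
      dist_fst_le[of y x] dist_snd_le[of y x] by simp
  then show "\<exists>d>0. \<forall>b y. \<bar>b - a\<bar> < d \<and> dist y x < d \<longrightarrow> dist (b *\<^sub>R y) (a *\<^sub>R x) < e"
    using d1(1) d2(1) by (intro exI[of _ "min d1 d2"]) auto
  obtain V :: "'a set" where V: "open V" "0 \<in> V" "convex V" "V \<subseteq> ball 0 (e/2)"
    using frechet_locally_convex[OF e] by blast
  obtain W :: "'b set" where W: "open W" "0 \<in> W" "convex W" "W \<subseteq> ball 0 (e/2)"
    using frechet_locally_convex[OF e] by blast
  have "\<forall>x\<in>V \<times> W. dist 0 x < e"
  proof
    fix x assume "x \<in> V \<times> W"
    then have "dist 0 (fst x) < e / 2" "dist 0 (snd x) < e / 2"
      using V(4) W(4) by auto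
    then show "dist 0 x < e" using le[of 0 x] by simp
  qed
  with V(1,2,3) W(1,2,3) show "\<exists>V. open V \<and> (0::'a \<times> 'b) \<in> V \<and> (\<forall>x\<in>V. dist 0 x < e) \<and>
      (\<forall>x\<in>V. \<forall>y\<in>V. \<forall>u\<ge>0. \<forall>v\<ge>0. u + v = 1 \<longrightarrow> u *\<^sub>R x + v *\<^sub>R y \<in> V)"
    by (intro exI[of _ "V \<times> W"]) (auto simp: open_Times zero_prod_def convex_def)
qed

text \<open>The mean value theorem is stated for convex open sets of slopes, which makes it
  accessible to bisection and avoids both integrals and the Hahn--Banach theorem.\<close>

lemma frechet_mvt:
  fixes c :: "real \<Rightarrow> 'a::frechet_space"
  assumes "open C" "convex C" "a < b"
    and der: "\<And>t. t \<in> {a..b} \<Longrightarrow> \<exists>l\<in>C. has_curve_deriv c {a..b} t l"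
  shows "(c b - c a) /\<^sub>R (b - a) \<in> C"
proof -
  \<comment> \<open>The slope over a union of adjacent intervals is the average of the two slopes,
    weighted by the lengths. This is the only use of convexity.\<close>
  have comb: "(c w - c u) /\<^sub>R (w - u) \<in> C"
    if "u < v" "v < w" "(c v - c u) /\<^sub>R (v - u) \<in> C" "(c w - c v) /\<^sub>R (w - v) \<in> C" for u v w
  proof -
    have "((v - u) / (w - u)) *\<^sub>R ((c v - c u) /\<^sub>R (v - u)) + ((w - v) / (w - u)) *\<^sub>R ((c w - c v) /\<^sub>R (w - v)) \<in> C"
      using that by (intro convexD[OF assms(2)]) (auto simp: divide_simps)
    also have "((v - u) / (w - u)) *\<^sub>R ((c v - c u) /\<^sub>R (v - u)) = (c v - c u) /\<^sub>R (w - u)"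
      using that by (simp add: field_simps)
    also have "((w - v) / (w - u)) *\<^sub>R ((c w - c v) /\<^sub>R (w - v)) = (c w - c v) /\<^sub>R (w - u)"
      using that by (simp add: field_simps)
    also have "(c v - c u) /\<^sub>R (w - u) + (c w - c v) /\<^sub>R (w - u) = (c w - c u) /\<^sub>R (w - u)"
      by (simp add: scaleR_right_distrib[symmetric])
    finally show ?thesis .
  qed
  \<comment> \<open>The guards make \<open>P\<close> vacuous for degenerate intervals and for those
    that reach outside \<open>{a..b}\<close>; the bisection principle admits both.\<close>
  define P where "P = (\<lambda>u v. a \<le> u \<and> u < v \<and> v \<le> b \<longrightarrow> (c v - c u) /\<^sub>R (v - u) \<in> C)"
  have "a \<le> b" using assms by simp
  then have "P a b"
  proof (induction rule: Bolzano)
    case (trans u v w)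
    show ?case
      unfolding P_def
    proof
      assume uw: "a \<le> u \<and> u < w \<and> w \<le> b"
      then consider "u < v" "v < w" | "u = v" "v \<noteq> w" | "v = w" "u \<noteq> v"
        using trans by linarith
      then show "(c w - c u) /\<^sub>R (w - u) \<in> C"
      proof cases
        case 1
        then show ?thesis using trans uw by (intro comb[of u v w]) (auto simp: P_def)
      qed (use trans uw in \<open>auto simp: P_def\<close>)
    qed
  next
    case (local x)
    then obtain l where "l \<in> C" "has_curve_deriv c {a..b} x l"
      using der[of x] by auto
    \<comment> \<open>Difference quotients based at \<open>x\<close> lie in the open set
      \<open>C\<close> near \<open>x\<close>. A short interval containing \<open>x\<close> is cut at
      \<open>x\<close>, so that both halves have such a quotient as slope.\<close>
    then have "eventually (\<lambda>s. (c s - c x) /\<^sub>R (s - x) \<in> C) (at x within {a..b})"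
      unfolding has_curve_deriv_def using assms(1) topological_tendstoD by blast
    then obtain d where d: "d > 0" "\<And>s. s \<in> {a..b} \<Longrightarrow> s \<noteq> x \<Longrightarrow> dist s x < d \<Longrightarrow> (c s - c x) /\<^sub>R (s - x) \<in> C"
      unfolding eventually_at by blast
    have "(c v - c u) /\<^sub>R (v - u) \<in> C" 
      if uv: "u \<le> x" "x \<le> v" "v - u < d" "a \<le> u" "u < v" "v \<le> b" for u v
    proof -
      have v: "(c v - c x) /\<^sub>R (v - x) \<in> C" if "x \<noteq> v"
        using d(2)[of v] that \<open>x \<le> v\<close> \<open>u \<le> x\<close> \<open>v - u < d\<close> \<open>a \<le> u\<close> \<open>v \<le> b\<close> by (auto simp: dist_real_def)
      have u: "(c x - c u) /\<^sub>R (x - u) \<in> C" if "x \<noteq> u"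
      proof -
        have "(c u - c x) /\<^sub>R (u - x) \<in> C"
          using d(2)[of u] that \<open>x \<le> v\<close> \<open>u \<le> x\<close> \<open>v - u < d\<close> \<open>a \<le> u\<close> \<open>v \<le> b\<close> by (auto simp: dist_real_def)
        also have "(c u - c x) /\<^sub>R (u - x) = (c x - c u) /\<^sub>R (x - u)"
          by (metis inverse_minus_eq minus_diff_eq scaleR_minus_left scaleR_minus_right)
        finally show ?thesis .
      qed
      consider "u < x" "x < v" | "x = u" "x \<noteq> v" | "x = v" "x \<noteq> u"
        using uv by linarith
      then show ?thesis
      proof cases
        case 1
        then show ?thesis using u v by (intro comb[of u x v]) auto
      qed (use u v in auto)
    qed
    then show ?case using d(1) unfolding P_def by (intro exI[of _ d]) auto
  qed
  then show ?thesis using assms(3) by (simp add: P_def)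
qed

section \<open>Rules for derivatives of curves\<close>

lemma has_curve_deriv_subset:
  "has_curve_deriv c S t l \<Longrightarrow> T \<subseteq> S \<Longrightarrow> has_curve_deriv c T t l"
  unfolding has_curve_deriv_def by (rule tendsto_within_subset)

lemma has_curve_deriv_transform:
  assumes "has_curve_deriv c S t l" "eventually (\<lambda>s. c s = c' s) (at t within S)" "c t = c' t"
  shows "has_curve_deriv c' S t l"
proof -
  have "eventually (\<lambda>s. (c s - c t) /\<^sub>R (s - t) = (c' s - c' t) /\<^sub>R (s - t)) (at t within S)"
    using assms(2) by eventually_elim (simp add: assms(3))
  from tendsto_cong[OF this] show ?thesis
    using assms(1) unfolding has_curve_deriv_def by blast
qed

lemma has_curve_deriv_unique:
  assumes "has_curve_deriv c S t l" "has_curve_deriv c S t l'" "at t within S \<noteq> bot"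
  shows "l = l'"
  using assms tendsto_unique unfolding has_curve_deriv_def by blast

lemma curve_deriv_eq:
  assumes "has_curve_deriv c S t l" "at t within S \<noteq> bot"
  shows "curve_deriv c S t = l"
  using assms unfolding has_curve_deriv_def curve_deriv_def by (simp add: tendsto_Lim)

lemma has_dir_derivD:
  assumes "has_dir_deriv f x h"
  shows "has_curve_deriv (\<lambda>t. f (x + t *\<^sub>R h)) UNIV 0 (dir_deriv f x h)"
  using assms unfolding has_dir_deriv_def has_curve_deriv_def dir_deriv_def
  by (auto simp: tendsto_Lim)

lemma dir_deriv_eq:
  assumes "has_curve_deriv (\<lambda>t. f (x + t *\<^sub>R h)) UNIV 0 l"
  shows "has_dir_deriv f x h" "dir_deriv f x h = l"
  using assms unfolding has_dir_deriv_def has_curve_deriv_def dir_deriv_def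
  by (auto simp: tendsto_Lim)

lemma has_curve_deriv_continuous:
  fixes c :: "real \<Rightarrow> 'a::frechet_space"
  assumes "has_curve_deriv c S t l"
  shows "(c \<longlongrightarrow> c t) (at t within S)"
proof -
  have "((\<lambda>s. (s - t) *\<^sub>R ((c s - c t) /\<^sub>R (s - t)) + c t) \<longlongrightarrow> (t - t) *\<^sub>R l + c t) (at t within S)"
    by (intro tendsto_add tendsto_scaleR_frechet tendsto_diff tendsto_ident_at tendsto_const)
      (use assms in \<open>simp add: has_curve_deriv_def\<close>)
  also have "?this \<longleftrightarrow> (c \<longlongrightarrow> (t - t) *\<^sub>R l + c t) (at t within S)"
    by (intro tendsto_cong) (auto simp: eventually_at_filter)
  finally show ?thesis by simp
qed

lemma has_curve_deriv_const: "has_curve_deriv (\<lambda>_. x::'a::frechet_space) S t 0"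
  by (simp add: has_curve_deriv_def)

lemma has_curve_deriv_id_scaleR:
  fixes x :: "'a::frechet_space"
  shows "has_curve_deriv (\<lambda>s. s *\<^sub>R x) S t x"
proof -
  have "((\<lambda>s. (s *\<^sub>R x - t *\<^sub>R x) /\<^sub>R (s - t)) \<longlongrightarrow> x) (at t within S) \<longleftrightarrow> ((\<lambda>_. x) \<longlongrightarrow> x) (at t within S)"
    by (intro tendsto_cong) (auto simp: eventually_at_filter scaleR_diff_left[symmetric])
  then show ?thesis by (simp add: has_curve_deriv_def)
qed

lemma has_curve_deriv_add:
  fixes c d :: "real \<Rightarrow> 'a::frechet_space"
  assumes "has_curve_deriv c S t l" "has_curve_deriv d S t m"
  shows "has_curve_deriv (\<lambda>s. c s + d s) S t (l + m)"
proof -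
  have "(c s + d s - (c t + d t)) /\<^sub>R (s - t) = (c s - c t) /\<^sub>R (s - t) + (d s - d t) /\<^sub>R (s - t)" for s
    by (simp add: scaleR_right_distrib[symmetric])
  then show ?thesis
    using assms unfolding has_curve_deriv_def by (simp add: tendsto_add)
qed

lemma has_curve_deriv_scaleR_const:
  fixes c :: "real \<Rightarrow> 'a::frechet_space"
  assumes "has_curve_deriv c S t l"
  shows "has_curve_deriv (\<lambda>s. r *\<^sub>R c s) S t (r *\<^sub>R l)"
proof -
  have "(r *\<^sub>R c s - r *\<^sub>R c t) /\<^sub>R (s - t) = r *\<^sub>R ((c s - c t) /\<^sub>R (s - t))" for s
    by (simp add: scaleR_right_diff_distrib mult.commute)
  then show ?thesis
    using tendsto_scaleR_frechet[OF tendsto_const assms[unfolded has_curve_deriv_def]]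
    by (simp only: has_curve_deriv_def)
qed

text \<open>The product rule for the one varying scalar factor that occurs, the parameter itself:
  variation fields along a ray have the form \<open>s *\<^sub>R c s\<close>.\<close>

lemma has_curve_deriv_id_mult:
  fixes c :: "real \<Rightarrow> 'a::frechet_space"
  assumes "has_curve_deriv c S t l"
  shows "has_curve_deriv (\<lambda>s. s *\<^sub>R c s) S t (c t + t *\<^sub>R l)"
proof -
  \<comment> \<open>The increment of \<open>s *\<^sub>R c s\<close> is split as
    \<open>(s - t) *\<^sub>R c s + t *\<^sub>R (c s - c t)\<close>.\<close>
  have "((\<lambda>s. c s + t *\<^sub>R ((c s - c t) /\<^sub>R (s - t))) \<longlongrightarrow> c t + t *\<^sub>R l) (at t within S)"
    using assms has_curve_deriv_continuous[OF assms] unfolding has_curve_deriv_def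
    by (intro tendsto_add tendsto_scaleR_frechet tendsto_const)
  also have "?this \<longleftrightarrow> has_curve_deriv (\<lambda>s. s *\<^sub>R c s) S t (c t + t *\<^sub>R l)"
    unfolding has_curve_deriv_def
  proof (intro tendsto_cong, unfold eventually_at_filter, intro always_eventually allI impI)
    fix s assume "s \<noteq> t"
    then have "c s = (s - t) *\<^sub>R (c s /\<^sub>R (s - t))" by simp
    then have "c s = (s *\<^sub>R c s - t *\<^sub>R c s) /\<^sub>R (s - t)"
      using \<open>s \<noteq> t\<close> by (simp add: scaleR_diff_left[symmetric])
    then show "c s + t *\<^sub>R ((c s - c t) /\<^sub>R (s - t)) = (s *\<^sub>R c s - t *\<^sub>R c t) /\<^sub>R (s - t)"
      by (simp add: algebra_simps)
  qed
  finally show ?thesis .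
qed

lemma has_curve_deriv_rescale:
  fixes c :: "real \<Rightarrow> 'a::frechet_space"
  assumes "has_curve_deriv c S (r * t) l" "r \<noteq> 0" "(\<lambda>s. r * s) ` T \<subseteq> S"
  shows "has_curve_deriv (\<lambda>s. c (r * s)) T t (r *\<^sub>R l)"
proof -
  have "filterlim (\<lambda>s. r * s) (at (r * t) within S) (at t within T)"
    using assms(2,3) unfolding filterlim_at
    by (auto simp: eventually_at_filter intro!: tendsto_intros always_eventually)
  from filterlim_compose[OF assms(1)[unfolded has_curve_deriv_def] this]
  have "((\<lambda>s. r *\<^sub>R ((c (r * s) - c (r * t)) /\<^sub>R (r * s - r * t))) \<longlongrightarrow> r *\<^sub>R l) (at t within T)"
    by (intro tendsto_scaleR_frechet tendsto_const)
  moreover have "r *\<^sub>R ((c (r * s) - c (r * t)) /\<^sub>R (r * s - r * t)) = (c (r * s) - c (r * t)) /\<^sub>R (s - t)" for s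
    using assms(2) by (simp add: right_diff_distrib[symmetric])
  ultimately show ?thesis by (simp only: has_curve_deriv_def)
qed

lemma has_curve_deriv_real_iff:
  fixes f :: "real \<Rightarrow> real"
  shows "has_curve_deriv f S t l \<longleftrightarrow> (f has_real_derivative l) (at t within S)"
  by (simp add: has_curve_deriv_def has_field_derivative_iff divide_inverse_commute)

text \<open>Smoothness enters the rules below through this first-order property, applied to a map or
  to its directional derivatives. Linearity in \<open>h\<close> is a consequence: see
  \<open>dir_deriv_scaleR\<close> and \<open>dir_deriv_add\<close>.\<close>

definition C1_on ::
  "'a::frechet_space set \<Rightarrow> ('a \<Rightarrow> 'b::frechet_space) \<Rightarrow> bool" where
  "C1_on U f \<longleftrightarrow> open U \<and> (\<forall>x\<in>U. \<forall>h. has_dir_deriv f x h) \<and>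
     continuous_on (U \<times> UNIV) (\<lambda>(x, h). dir_deriv f x h)"

lemma C1_on_line:
  assumes "C1_on U f" "x + t *\<^sub>R h \<in> U"
  shows "has_curve_deriv (\<lambda>s. f (x + s *\<^sub>R h)) S t (dir_deriv f (x + t *\<^sub>R h) h)"
proof -
  have "has_curve_deriv (\<lambda>s. f ((x + t *\<^sub>R h) + s *\<^sub>R h)) UNIV 0 (dir_deriv f (x + t *\<^sub>R h) h)"
    using assms by (intro has_dir_derivD) (auto simp: C1_on_def)
  then have "((\<lambda>s. (f ((x + t *\<^sub>R h) + s *\<^sub>R h) - f (x + t *\<^sub>R h)) /\<^sub>R s) \<longlongrightarrow> dir_deriv f (x + t *\<^sub>R h) h) (at 0)"
    by (simp add: has_curve_deriv_def)
  then have "has_curve_deriv (\<lambda>s. f (x + s *\<^sub>R h)) UNIV t (dir_deriv f (x + t *\<^sub>R h) h)"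
    unfolding has_curve_deriv_def
    by (subst filterlim_at_to_0) (simp add: algebra_simps)
  then show ?thesis by (rule has_curve_deriv_subset) simp
qed

text \<open>Strict differentiability, from which the chain rule, the linearity of the derivative and
  the symmetry of second derivatives all follow.\<close>

lemma C1_on_strict:
  fixes f :: "'a::frechet_space \<Rightarrow> 'b::frechet_space"
  assumes "C1_on U f" "x \<in> U"
  shows "((\<lambda>(b, k, t). (f (b + t *\<^sub>R k) - f b) /\<^sub>R t) \<longlongrightarrow> dir_deriv f x h)
    (nhds x \<times>\<^sub>F (nhds h \<times>\<^sub>F at 0))"
proof (rule topological_tendstoI)
  fix S assume "open S" "dir_deriv f x h \<in> S"
  then obtain C where C: "open C" "convex C" "dir_deriv f x h \<in> C" "C \<subseteq> S"
    by (rule frechet_convex_nhd)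
  have U: "open U" and cont: "continuous_on (U \<times> UNIV) (\<lambda>(x, h). dir_deriv f x h)"
    using assms(1) by (auto simp: C1_on_def)
  have "open ((\<lambda>(x, h). dir_deriv f x h) -` C \<inter> (U \<times> (UNIV::'a set)))"
    using continuous_on_open_vimage[OF open_Times[OF U open_UNIV]] cont C(1) by blast
  then have "open ((U \<times> UNIV) \<inter> (\<lambda>(x, h). dir_deriv f x h) -` C)"
    by (simp only: Int_commute)
  moreover have "(x, h) \<in> (U \<times> UNIV) \<inter> (\<lambda>(x, h). dir_deriv f x h) -` C"
    using C(3) assms(2) by simp
  ultimately obtain A' B where AB: "open A'" "open B" "x \<in> A'" "h \<in> B"
    "A' \<times> B \<subseteq> (U \<times> UNIV) \<inter> (\<lambda>(x, h). dir_deriv f x h) -` C"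
    by (rule open_prod_elim) auto
  \<comment> \<open>Convexity is asked of the base points, because the segment from \<open>b\<close>
    to \<open>b + t *\<^sub>R k\<close> has to stay inside; the direction \<open>k\<close> is fixed
    along it.\<close>
  obtain A where A: "open A" "convex A" "x \<in> A" "A \<subseteq> A'"
    using frechet_convex_nhd[OF AB(1,3)] .
  let ?F = "nhds x \<times>\<^sub>F (nhds h \<times>\<^sub>F at (0::real))"
  have lims: "((\<lambda>p. fst p) \<longlongrightarrow> x) ?F" "((\<lambda>p. fst (snd p)) \<longlongrightarrow> h) ?F" "filterlim (\<lambda>p. snd (snd p)) (at 0) ?F"
    by (auto intro: filterlim_fst filterlim_snd filterlim_compose[OF filterlim_fst filterlim_snd]
      filterlim_compose[OF filterlim_snd filterlim_snd])
  have t0: "((\<lambda>p. snd (snd p)) \<longlongrightarrow> 0) ?F" and tn: "eventually (\<lambda>p. snd (snd p) \<noteq> 0) ?F"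
    using lims(3) by (auto simp: filterlim_at)
  have "((\<lambda>p. fst p + snd (snd p) *\<^sub>R fst (snd p)) \<longlongrightarrow> x + 0 *\<^sub>R h) ?F"
    by (intro tendsto_add tendsto_scaleR_frechet lims t0)
  then have "eventually (\<lambda>p. fst p + snd (snd p) *\<^sub>R fst (snd p) \<in> A) ?F"
    using A topological_tendstoD by fastforce
  moreover have "eventually (\<lambda>p. fst p \<in> A) ?F" "eventually (\<lambda>p. fst (snd p) \<in> B) ?F"
    using topological_tendstoD[OF lims(1) A(1,3)] topological_tendstoD[OF lims(2) AB(2,4)] by auto
  ultimately show "eventually (\<lambda>p. (case p of (b, k, t) \<Rightarrow> (f (b + t *\<^sub>R k) - f b) /\<^sub>R t) \<in> S) ?F"
    using tn
  proof eventually_elim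
    case (elim p)
    obtain b k t where p: "p = (b, k, t)" by (metis surj_pair)
    have bkt: "b \<in> A" "b + t *\<^sub>R k \<in> A" "k \<in> B" "t \<noteq> 0"
      using elim p by auto
    have seg: "b + \<sigma> *\<^sub>R k \<in> A" if "\<sigma> \<in> closed_segment 0 t" for \<sigma>
    proof -
      from that obtain u where u: "0 \<le> u" "u \<le> 1" "\<sigma> = u * t"
        by (auto simp: in_segment)
      have "(1 - u) *\<^sub>R b + u *\<^sub>R (b + t *\<^sub>R k) \<in> A"
        using u bkt by (intro convexD[OF A(2)]) auto
      then show ?thesis using u by (simp add: algebra_simps)
    qed
    have der: "\<exists>l\<in>C. has_curve_deriv (\<lambda>s. f (b + s *\<^sub>R k)) T \<sigma> l" if "\<sigma> \<in> closed_segment 0 t" for \<sigma> T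
    proof
      have "(b + \<sigma> *\<^sub>R k, k) \<in> A' \<times> B" using seg[OF that] A(4) bkt by auto
      with AB(5) have "b + \<sigma> *\<^sub>R k \<in> U" "dir_deriv f (b + \<sigma> *\<^sub>R k) k \<in> C" by auto
      then show "has_curve_deriv (\<lambda>s. f (b + s *\<^sub>R k)) T \<sigma> (dir_deriv f (b + \<sigma> *\<^sub>R k) k)"
        "dir_deriv f (b + \<sigma> *\<^sub>R k) k \<in> C"
        using C1_on_line[OF assms(1)] by auto
    qed
    have "(f (b + t *\<^sub>R k) - f b) /\<^sub>R t \<in> C"
    proof (cases "t > 0")
      case True
      then show ?thesis
        using frechet_mvt[OF C(1,2), of 0 t "\<lambda>s. f (b + s *\<^sub>R k)"] der
        by (auto simp: closed_segment_eq_real_ivl)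
    next
      case False
      \<comment> \<open>For negative \<open>t\<close> the mean value theorem runs over
        \<open>{t..0}\<close>; numerator and denominator both change sign.\<close>
      then have "(f b - f (b + t *\<^sub>R k)) /\<^sub>R (- t) \<in> C"
        using frechet_mvt[OF C(1,2), of t 0 "\<lambda>s. f (b + s *\<^sub>R k)"] der bkt(4)
        by (auto simp: closed_segment_eq_real_ivl)
      also have "(f b - f (b + t *\<^sub>R k)) /\<^sub>R (- t) = (f (b + t *\<^sub>R k) - f b) /\<^sub>R t"
        by (metis inverse_minus_eq minus_diff_eq scaleR_minus_left scaleR_minus_right)
      finally show ?thesis .
    qed
    then show ?case using C(4) p by auto
  qed
qed

text \<open>The working form of strict differentiability: base point, direction and step size vary
  together along any filter. The chain rule, additivity, the symmetry of second derivatives and the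
  product rule for the metric are obtained by choosing \<open>b\<close>, \<open>k\<close> and
  \<open>t\<close>.\<close>

lemma C1_on_tendsto:
  fixes f :: "'a::frechet_space \<Rightarrow> 'b::frechet_space"
  assumes "C1_on U f" "x \<in> U" "(b \<longlongrightarrow> x) F" "(k \<longlongrightarrow> h) F" "filterlim t (at 0) F"
  shows "((\<lambda>i. (f (b i + t i *\<^sub>R k i) - f (b i)) /\<^sub>R t i) \<longlongrightarrow> dir_deriv f x h) F"
proof -
  have "filterlim (\<lambda>i. (b i, k i, t i)) (nhds x \<times>\<^sub>F (nhds h \<times>\<^sub>F at 0)) F"
    using assms by (intro filterlim_Pair)
  from filterlim_compose[OF C1_on_strict[OF assms(1,2)] this] show ?thesis by simp
qed

text \<open>Here \<open>c s\<close> is \<open>c t\<close> plus \<open>s - t\<close> times the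
  difference quotient of \<open>c\<close>. The direction thus varies with \<open>s\<close> and
  converges to \<open>l\<close>, which strict differentiability allows.\<close>

lemma C1_on_chain:
  fixes f :: "'a::frechet_space \<Rightarrow> 'b::frechet_space"
  assumes "C1_on U f" "c t \<in> U" "has_curve_deriv c S t l"
  shows "has_curve_deriv (\<lambda>s. f (c s)) S t (dir_deriv f (c t) l)"
proof -
  have "filterlim (\<lambda>s. s - t) (at 0) (at t within S)"
    unfolding filterlim_at by (auto simp: eventually_at_filter intro!: tendsto_eq_intros)
  from C1_on_tendsto[OF assms(1,2) tendsto_const assms(3)[unfolded has_curve_deriv_def] this]
  have "((\<lambda>s. (f (c t + (s - t) *\<^sub>R ((c s - c t) /\<^sub>R (s - t))) - f (c t)) /\<^sub>R (s - t)) \<longlongrightarrow> dir_deriv f (c t) l) (at t within S)" .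
  also have "?this \<longleftrightarrow> has_curve_deriv (\<lambda>s. f (c s)) S t (dir_deriv f (c t) l)"
    unfolding has_curve_deriv_def
    by (intro tendsto_cong) (auto simp: eventually_at_filter)
  finally show ?thesis .
qed

lemma dir_deriv_compose:
  fixes f :: "'a::frechet_space \<Rightarrow> 'b::frechet_space" and g :: "'c::frechet_space \<Rightarrow> 'a"
  assumes "C1_on U f" "g x \<in> U" "has_dir_deriv g x h"
  shows "dir_deriv (\<lambda>y. f (g y)) x h = dir_deriv f (g x) (dir_deriv g x h)"
  using C1_on_chain[OF assms(1) _ has_dir_derivD[OF assms(3)]] assms(2)
  by (auto intro: dir_deriv_eq)

lemma dir_deriv_cong:
  fixes f g :: "'a::frechet_space \<Rightarrow> 'b::frechet_space"
  assumes "open U" "x \<in> U" "\<And>y. y \<in> U \<Longrightarrow> f y = g y"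
  shows "dir_deriv f x h = dir_deriv g x h"
proof -
  have "eventually (\<lambda>t. x + t *\<^sub>R h \<in> U) (at 0)"
    by (rule topological_tendstoD[OF tendsto_along_line assms(1,2)])
  then have "eventually (\<lambda>t. (f (x + t *\<^sub>R h) - f x) /\<^sub>R t = (g (x + t *\<^sub>R h) - g x) /\<^sub>R t) (at 0)"
    by eventually_elim (simp add: assms)
  \<comment> \<open>No existence of the limits is assumed: the predicates by which
    \<open>Lim\<close> picks its value coincide.\<close>
  from tendsto_cong[OF this] show ?thesis
    unfolding dir_deriv_def Topological_Spaces.Lim_def by (simp only:)
qed

lemma dir_deriv_ident: "dir_deriv (\<lambda>y. y) x h = (h::'a::frechet_space)"
proof (rule dir_deriv_eq(2))
  show "has_curve_deriv (\<lambda>t. x + t *\<^sub>R h) UNIV 0 h"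
    using has_curve_deriv_add[OF has_curve_deriv_const[of x UNIV 0] has_curve_deriv_id_scaleR[of h UNIV 0]] by simp
qed

lemma dir_deriv_zero: "dir_deriv f x 0 = (0::'b::frechet_space)"
  unfolding dir_deriv_def by (simp add: tendsto_Lim)

lemma dir_deriv_scaleR:
  fixes f :: "'a::frechet_space \<Rightarrow> 'b::frechet_space"
  assumes "C1_on U f" "x \<in> U"
  shows "dir_deriv f x (r *\<^sub>R h) = r *\<^sub>R dir_deriv f x h"
proof (cases "r = 0")
  case False
  have "has_curve_deriv (\<lambda>t. f (x + t *\<^sub>R h)) UNIV 0 (dir_deriv f x h)"
    using assms by (intro has_dir_derivD) (auto simp: C1_on_def)
  then have "has_curve_deriv (\<lambda>t. f (x + (r * t) *\<^sub>R h)) UNIV 0 (r *\<^sub>R dir_deriv f x h)"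
    using has_curve_deriv_rescale[of "\<lambda>t. f (x + t *\<^sub>R h)" UNIV r 0 _ UNIV] False by simp
  then show ?thesis by (intro dir_deriv_eq) (simp add: mult.commute)
qed (simp add: dir_deriv_zero)

text \<open>Move along \<open>h\<close> first and along \<open>k\<close> afterwards. The second
  quotient has the moving base point \<open>x + t *\<^sub>R h\<close>, which is where strictness
  enters.\<close>

lemma dir_deriv_add:
  fixes f :: "'a::frechet_space \<Rightarrow> 'b::frechet_space"
  assumes "C1_on U f" "x \<in> U"
  shows "dir_deriv f x (h + k) = dir_deriv f x h + dir_deriv f x k"
proof (rule dir_deriv_eq(2))
  have "((\<lambda>t. (f (x + t *\<^sub>R h) - f x) /\<^sub>R t + (f ((x + t *\<^sub>R h) + t *\<^sub>R k) - f (x + t *\<^sub>R h)) /\<^sub>R t)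
      \<longlongrightarrow> dir_deriv f x h + dir_deriv f x k) (at 0)"
    by (intro tendsto_add C1_on_tendsto[OF assms] tendsto_along_line tendsto_const filterlim_ident)
  then show "has_curve_deriv (\<lambda>t. f (x + t *\<^sub>R (h + k))) UNIV 0 (dir_deriv f x h + dir_deriv f x k)"
    by (simp add: has_curve_deriv_def scaleR_right_distrib[symmetric] add.assoc)
qed

text \<open>The second difference of \<open>f\<close> over a small parallelogram, divided by
  \<open>t\<close> twice, is symmetric in \<open>h\<close> and \<open>k\<close>. The mean value
  theorem along \<open>h\<close> shows that it tends to one iterated derivative; exchanging the
  roles gives the other.\<close>

lemma dir_deriv_symmetric:
  fixes f :: "'a::frechet_space \<Rightarrow> 'b::frechet_space"
  assumes f: "C1_on U f" and fh: "\<And>h. C1_on U (\<lambda>x. dir_deriv f x h)" and x: "x \<in> U"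
  shows "dir_deriv (\<lambda>y. dir_deriv f y h) x k = dir_deriv (\<lambda>y. dir_deriv f y k) x h"
proof -
  have lim: "((\<lambda>t. ((f (x + t *\<^sub>R h + t *\<^sub>R k) - f (x + t *\<^sub>R h) - f (x + t *\<^sub>R k) + f x) /\<^sub>R t) /\<^sub>R t)
      \<longlongrightarrow> dir_deriv (\<lambda>y. dir_deriv f y h) x k) (at_right 0)" for h k
  proof (rule topological_tendstoI)
    fix S assume "open S" "dir_deriv (\<lambda>y. dir_deriv f y h) x k \<in> S"
    then obtain C where C: "open C" "convex C" "dir_deriv (\<lambda>y. dir_deriv f y h) x k \<in> C" "C \<subseteq> S"
      by (rule frechet_convex_nhd)
    have "((\<lambda>p. (dir_deriv f (fst p + snd p *\<^sub>R k) h - dir_deriv f (fst p) h) /\<^sub>R snd p)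
        \<longlongrightarrow> dir_deriv (\<lambda>y. dir_deriv f y h) x k) (nhds x \<times>\<^sub>F at 0)"
      by (intro C1_on_tendsto[OF fh x] filterlim_fst filterlim_snd tendsto_const)
    from topological_tendstoD[OF this C(1,3)] obtain P Q where
      PQ: "eventually P (nhds x)" "eventually Q (at 0)"
        "\<And>b t. P b \<Longrightarrow> Q t \<Longrightarrow> (dir_deriv f (b + t *\<^sub>R k) h - dir_deriv f b h) /\<^sub>R t \<in> C"
      unfolding eventually_prod_filter by auto
    obtain A' where A': "open A'" "x \<in> A'" "\<And>b. b \<in> A' \<Longrightarrow> P b"
      using PQ(1) unfolding eventually_nhds by blast
    have "open (A' \<inter> U)" "x \<in> A' \<inter> U" using A' f x by (auto simp: C1_on_def)
    then obtain A where A: "open A" "convex A" "x \<in> A" "A \<subseteq> A' \<inter> U"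
      by (rule frechet_convex_nhd)
    have near: "eventually (\<lambda>t. x + t *\<^sub>R h' \<in> A) (at_right 0)" for h'
      by (rule topological_tendstoD[OF tendsto_along_line A(1,3)])
    have "eventually Q (at_right 0)"
      using PQ(2) by (auto simp: eventually_at_split)
    \<comment> \<open>Together with \<open>x\<close> these are the corners of the parallelogram; by
      convexity \<open>A\<close> then contains its two sides parallel to \<open>h\<close>.\<close>
    with near[of h] near[of k] near[of "h + k"] eventually_at_right_less[of 0]
    show "eventually (\<lambda>t. ((f (x + t *\<^sub>R h + t *\<^sub>R k) - f (x + t *\<^sub>R h) - f (x + t *\<^sub>R k) + f x) /\<^sub>R t) /\<^sub>R t \<in> S) (at_right 0)"
    proof eventually_elim
      case (elim t)
      have in_A: "x + \<sigma> *\<^sub>R h \<in> A" "x + \<sigma> *\<^sub>R h + t *\<^sub>R k \<in> A" if "\<sigma> \<in> {0..t}" for \<sigma>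
      proof -
        have "(1 - \<sigma> / t) *\<^sub>R x + (\<sigma> / t) *\<^sub>R (x + t *\<^sub>R h) \<in> A"
          using that elim A by (intro convexD[OF A(2)]) auto
        then show "x + \<sigma> *\<^sub>R h \<in> A" using elim by (simp add: algebra_simps)
        have "(1 - \<sigma> / t) *\<^sub>R (x + t *\<^sub>R k) + (\<sigma> / t) *\<^sub>R (x + t *\<^sub>R (h + k)) \<in> A"
          using that elim A by (intro convexD[OF A(2)]) auto
        then show "x + \<sigma> *\<^sub>R h + t *\<^sub>R k \<in> A" using elim by (simp add: algebra_simps)
      qed
      \<comment> \<open>The first difference in direction \<open>k\<close>, already divided by
        \<open>t\<close>. Its derivatives are the quotients controlled by \<open>PQ(3)\<close>,
        hence lie in \<open>C\<close>.\<close>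
      define c where "c = (\<lambda>\<sigma>. inverse t *\<^sub>R (f ((x + t *\<^sub>R k) + \<sigma> *\<^sub>R h) + (-1) *\<^sub>R f (x + \<sigma> *\<^sub>R h)))"
      have "\<exists>l\<in>C. has_curve_deriv c {0..t} \<sigma> l" if "\<sigma> \<in> {0..t}" for \<sigma>
      proof
        show "has_curve_deriv c {0..t} \<sigma> (inverse t *\<^sub>R (dir_deriv f ((x + t *\<^sub>R k) + \<sigma> *\<^sub>R h) h + (-1) *\<^sub>R dir_deriv f (x + \<sigma> *\<^sub>R h) h))"
          unfolding c_def using in_A[OF that] A(4)
          by (intro has_curve_deriv_scaleR_const has_curve_deriv_add C1_on_line[OF f])
            (auto simp: add.assoc add.left_commute add.commute)
        have "(dir_deriv f (x + \<sigma> *\<^sub>R h + t *\<^sub>R k) h - dir_deriv f (x + \<sigma> *\<^sub>R h) h) /\<^sub>R t \<in> C"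
          using A'(3)[of "x + \<sigma> *\<^sub>R h"] in_A[OF that] A(4) elim by (intro PQ(3)) auto
        moreover have "x + \<sigma> *\<^sub>R h + t *\<^sub>R k = (x + t *\<^sub>R k) + \<sigma> *\<^sub>R h" by (simp add: algebra_simps)
        ultimately show "inverse t *\<^sub>R (dir_deriv f ((x + t *\<^sub>R k) + \<sigma> *\<^sub>R h) h + (-1) *\<^sub>R dir_deriv f (x + \<sigma> *\<^sub>R h) h) \<in> C"
          by simp
      qed
      then have "(c t - c 0) /\<^sub>R (t - 0) \<in> C"
        using elim by (intro frechet_mvt[OF C(1,2)]) auto
      also have "c t - c 0 = (f (x + t *\<^sub>R h + t *\<^sub>R k) - f (x + t *\<^sub>R h) - f (x + t *\<^sub>R k) + f x) /\<^sub>R t"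
        by (simp add: c_def algebra_simps)
      finally show ?case using C(4) by auto
    qed
  qed
  have "x + t *\<^sub>R h + t *\<^sub>R k = x + t *\<^sub>R k + t *\<^sub>R h" for t by (simp add: algebra_simps)
  then have "((\<lambda>t. ((f (x + t *\<^sub>R h + t *\<^sub>R k) - f (x + t *\<^sub>R h) - f (x + t *\<^sub>R k) + f x) /\<^sub>R t) /\<^sub>R t)
      \<longlongrightarrow> dir_deriv (\<lambda>y. dir_deriv f y k) x h) (at_right 0)"
    using lim[of k h] by (simp add: algebra_simps)
  with lim[of h k] show ?thesis
    using tendsto_unique trivial_limit_at_right_real by blast
qed

section \<open>From smooth maps and their directional derivatives to C1 maps\<close>

lemma iter_deriv_dir_deriv:
  "iter_deriv n (\<lambda>x. dir_deriv f x k) v = iter_deriv (Suc n) f (case_nat k v)"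
proof (induction n)
  case (Suc n)
  have "iter_deriv (Suc n) (\<lambda>x. dir_deriv f x k) v = (\<lambda>x. dir_deriv (iter_deriv n (\<lambda>x. dir_deriv f x k) v) x (v n))"
    by (rule iter_deriv.simps(2))
  also have "\<dots> = (\<lambda>x. dir_deriv (iter_deriv (Suc n) f (case_nat k v)) x (case_nat k v (Suc n)))"
    by (simp only: Suc nat.case)
  also have "\<dots> = iter_deriv (Suc (Suc n)) f (case_nat k v)"
    by (rule iter_deriv.simps(2)[symmetric])
  finally show ?case .
qed simp

lemma continuous_on_case_nat_seq:
  "continuous_on S (\<lambda>(x::'a::topological_space, v::nat \<Rightarrow> 'b::topological_space). (x, case_nat k v))"
proof -
  have "continuous_on S (\<lambda>p::'a \<times> (nat \<Rightarrow> 'b). case_nat k (snd p) i)" for i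
  proof (cases i)
    case (Suc j)
    have "continuous_on S (\<lambda>p::'a \<times> (nat \<Rightarrow> 'b). snd p j)"
      by (rule continuous_on_product_then_coordinatewise[of S snd]) (rule continuous_on_snd[OF continuous_on_id])
    then show ?thesis using Suc by simp
  qed simp
  then have "continuous_on S (\<lambda>p::'a \<times> (nat \<Rightarrow> 'b). case_nat k (snd p))"
    by (rule continuous_on_coordinatewise_then_product)
  then show ?thesis
    unfolding case_prod_unfold by (intro continuous_on_Pair continuous_on_fst continuous_on_id)
qed

text \<open>A derivative taken beforehand in direction \<open>k\<close> amounts to prepending
  \<open>k\<close> to the sequence of directions. This shift is continuous for the product topology,
  so joint continuity is inherited.\<close>

lemma smooth_on_dir_deriv:
  assumes "smooth_on U f"
  shows "smooth_on U (\<lambda>x. dir_deriv f x k)"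
  unfolding smooth_on_def iter_deriv_dir_deriv
proof (intro conjI allI ballI)
  show "open U" using assms by (simp add: smooth_on_def)
  show "has_dir_deriv (iter_deriv (Suc n) f (case_nat k v)) x (v n)" if "x \<in> U" for n v x
  proof -
    have "has_dir_deriv (iter_deriv (Suc n) f (case_nat k v)) x (case_nat k v (Suc n))"
      using assms that unfolding smooth_on_def by blast
    then show ?thesis by simp
  qed
  show "continuous_on (U \<times> UNIV) (\<lambda>(x, v). iter_deriv (Suc n) f (case_nat k v) x)" for n
  proof -
    have "continuous_on (U \<times> UNIV) (\<lambda>(x, v). iter_deriv (Suc n) f v x)"
      using assms unfolding smooth_on_def by blast
    then have "continuous_on (U \<times> UNIV)
        (\<lambda>p. (\<lambda>(x, v). iter_deriv (Suc n) f v x) ((\<lambda>(x, v). (x, case_nat k v)) p))"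
      by (rule continuous_on_compose2[OF _ continuous_on_case_nat_seq]) auto
    then show ?thesis by (simp add: case_prod_unfold)
  qed
qed

lemma smooth_on_C1_on:
  assumes "smooth_on U f"
  shows "C1_on U f"
  unfolding C1_on_def
proof (intro conjI allI ballI)
  show "open U" using assms by (simp add: smooth_on_def)
  show "has_dir_deriv f x h" if "x \<in> U" for x h
  proof -
    have "has_dir_deriv (iter_deriv 0 f (\<lambda>_. h)) x ((\<lambda>_. h) 0)"
      using assms that unfolding smooth_on_def by blast
    then show ?thesis by simp
  qed
  have "continuous_on (U \<times> UNIV) (\<lambda>(x, v). iter_deriv (Suc 0) f v x)"
    using assms unfolding smooth_on_def by blast
  \<comment> \<open>A single direction is embedded as a constant sequence, of which
    \<open>iter_deriv (Suc 0)\<close> reads the entry 0.\<close>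
  moreover have "continuous_on (U \<times> UNIV) (\<lambda>p::'a \<times> 'a. (fst p, \<lambda>_::nat. snd p))"
    by (intro continuous_on_Pair continuous_on_fst continuous_on_snd continuous_on_id
      continuous_on_coordinatewise_then_product)
  ultimately have "continuous_on (U \<times> UNIV) (\<lambda>p::'a \<times> 'a. (\<lambda>(x, v). iter_deriv (Suc 0) f v x) (fst p, \<lambda>_::nat. snd p))"
    by (rule continuous_on_compose2) auto
  then show "continuous_on (U \<times> UNIV) (\<lambda>(x, h). dir_deriv f x h)"
    by (simp add: case_prod_unfold)
qed

lemma smooth_on_continuous_on:
  assumes "smooth_on U f"
  shows "continuous_on U f"
proof -
  have "continuous_on (U \<times> UNIV) (\<lambda>(x, v::nat \<Rightarrow> 'a). iter_deriv 0 f v x)"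
    using assms unfolding smooth_on_def by blast
  moreover have "continuous_on U (\<lambda>x. (x, undefined :: nat \<Rightarrow> 'a))"
    by (intro continuous_on_Pair continuous_on_id continuous_on_const)
  ultimately have "continuous_on U (\<lambda>x. (\<lambda>(x, v::nat \<Rightarrow> 'a). iter_deriv 0 f v x) (x, undefined))"
    by (rule continuous_on_compose2) auto
  then show ?thesis by simp
qed

section \<open>Charts, velocities and the metric in coordinates\<close>

text \<open>Continuity of velocities is given on the parameters whose points lie in a chart. Since
  chart domains are open, it yields limits within the whole parameter set.\<close>

lemma at_within_filter_eq:
  assumes "eventually P (at t within S)"
  shows "at t within {s \<in> S. P s} = at t within S"
  unfolding filter_eq_iff
proof
  fix Q
  show "eventually Q (at t within {s \<in> S. P s}) \<longleftrightarrow> eventually Q (at t within S)"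
    using assms unfolding eventually_at_filter
    by (auto elim: eventually_elim2)
qed

locale riemannian_manifold =
  fixes A :: "('m::t2_space, 'e::frechet_space) chart set"
    and \<gamma> :: "('m, 'e) tensor2"
    and \<Gamma> :: "('m, 'e) christoffel"
  assumes atlas: "smooth_atlas A"
    and metric: "riemannian_metric A \<gamma>"
    and levi_civita: "levi_civita A \<gamma> \<Gamma>"
begin

abbreviation g :: "('m, 'e) chart \<Rightarrow> 'e \<Rightarrow> 'e \<Rightarrow> 'e \<Rightarrow> real" where
  "g \<equiv> local_rep A \<gamma>"

lemma chart_at:
  obtains \<phi> where "\<phi> \<in> A" "x \<in> chart_dom \<phi>"
  using atlas unfolding smooth_atlas_def by blast

lemma
  assumes "\<phi> \<in> A"
  shows open_chart_dom: "open (chart_dom \<phi>)"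
    and open_chart_im: "open (chart_im \<phi>)"
    and continuous_on_coord: "continuous_on (chart_dom \<phi>) (coord \<phi>)"
    and chart_inv_coord: "\<And>x. x \<in> chart_dom \<phi> \<Longrightarrow> chart_inv \<phi> (coord \<phi> x) = x"
    and coord_chart_inv: "\<And>p. p \<in> chart_im \<phi> \<Longrightarrow> coord \<phi> (chart_inv \<phi> p) = p"
    and coord_in_chart_im: "\<And>x. x \<in> chart_dom \<phi> \<Longrightarrow> coord \<phi> x \<in> chart_im \<phi>"
    and chart_inv_in_chart_dom: "\<And>p. p \<in> chart_im \<phi> \<Longrightarrow> chart_inv \<phi> p \<in> chart_dom \<phi>"
proof -
  have h: "open (chart_dom \<phi>)" "open (chart_im \<phi>)"
    "homeomorphism (chart_dom \<phi>) (chart_im \<phi>) (coord \<phi>) (chart_inv \<phi>)"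
    using atlas assms unfolding smooth_atlas_def by auto
  then show "open (chart_dom \<phi>)" "open (chart_im \<phi>)" "continuous_on (chart_dom \<phi>) (coord \<phi>)"
    "\<And>x. x \<in> chart_dom \<phi> \<Longrightarrow> chart_inv \<phi> (coord \<phi> x) = x"
    "\<And>p. p \<in> chart_im \<phi> \<Longrightarrow> coord \<phi> (chart_inv \<phi> p) = p"
    "\<And>x. x \<in> chart_dom \<phi> \<Longrightarrow> coord \<phi> x \<in> chart_im \<phi>"
    "\<And>p. p \<in> chart_im \<phi> \<Longrightarrow> chart_inv \<phi> p \<in> chart_dom \<phi>"
    unfolding homeomorphism_def by auto
qed

lemma C1_on_transition:
  assumes "\<phi> \<in> A" "\<psi> \<in> A"
  shows "C1_on (coord \<phi> ` (chart_dom \<phi> \<inter> chart_dom \<psi>)) (transition \<phi> \<psi>)"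
  using atlas assms unfolding smooth_atlas_def by (auto intro: smooth_on_C1_on)

lemma transition_coord:
  "\<phi> \<in> A \<Longrightarrow> x \<in> chart_dom \<phi> \<Longrightarrow> transition \<phi> \<psi> (coord \<phi> x) = coord \<psi> x"
  by (simp add: transition_def chart_inv_coord)

lemma tendsto_coord:
  assumes "\<phi> \<in> A" "(c \<longlongrightarrow> x) F" "x \<in> chart_dom \<phi>"
  shows "((\<lambda>s. coord \<phi> (c s)) \<longlongrightarrow> coord \<phi> x) F"
proof -
  have "isCont (coord \<phi>) x"
    using continuous_on_coord[OF assms(1)] open_chart_dom[OF assms(1)] assms(3)
    by (simp add: continuous_on_eq_continuous_at)
  from isCont_tendsto_compose[OF this assms(2)] show ?thesis .
qed

lemma eventually_in_chart_dom:
  assumes "\<phi> \<in> A" "(c \<longlongrightarrow> x) F" "x \<in> chart_dom \<phi>"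
  shows "eventually (\<lambda>s. c s \<in> chart_dom \<phi>) F"
  by (rule topological_tendstoD[OF assms(2) open_chart_dom[OF assms(1)] assms(3)])

lemma has_curve_deriv_change_chart:
  assumes "\<phi> \<in> A" "\<psi> \<in> A" "c t \<in> chart_dom \<phi>" "c t \<in> chart_dom \<psi>"
    and "(c \<longlongrightarrow> c t) (at t within S)"
    and "has_curve_deriv (\<lambda>s. coord \<phi> (c s)) S t l"
  shows "has_curve_deriv (\<lambda>s. coord \<psi> (c s)) S t (dir_deriv (transition \<phi> \<psi>) (coord \<phi> (c t)) l)"
proof -
  have "has_curve_deriv (\<lambda>s. transition \<phi> \<psi> (coord \<phi> (c s))) S t (dir_deriv (transition \<phi> \<psi>) (coord \<phi> (c t)) l)"
    using assms by (intro C1_on_chain[OF C1_on_transition]) auto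
  moreover have "eventually (\<lambda>s. transition \<phi> \<psi> (coord \<phi> (c s)) = coord \<psi> (c s)) (at t within S)"
    using eventually_in_chart_dom[OF assms(1,5,3)] by eventually_elim (simp add: transition_coord assms)
  ultimately show ?thesis
    by (rule has_curve_deriv_transform) (simp add: transition_coord assms)
qed

section \<open>Tangent vectors and their coordinates\<close>

lemma tangent_of_self:
  assumes "\<phi> \<in> A" "x \<in> chart_dom \<phi>"
  shows "tangent_of A \<phi> x u \<phi> = u"
proof -
  have "dir_deriv (transition \<phi> \<phi>) (coord \<phi> x) u = dir_deriv (\<lambda>p. p) (coord \<phi> x) u"
    using assms by (intro dir_deriv_cong[OF open_chart_im])
      (auto simp: coord_in_chart_im transition_def coord_chart_inv)
  then show ?thesis using assms by (simp add: tangent_of_def dir_deriv_ident)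
qed

text \<open>Compatibility between two charts around \<open>x\<close> is the chain rule: near
  \<open>coord \<phi> x\<close>, \<open>transition \<psi> \<omega>\<close> after
  \<open>transition \<phi> \<psi>\<close> is \<open>transition \<phi> \<omega>\<close>.\<close>

lemma tangent_of_in_tangent_space:
  assumes "\<phi> \<in> A" "x \<in> chart_dom \<phi>"
  shows "tangent_of A \<phi> x u \<in> tangent_space A x"
  unfolding tangent_space_def
proof (intro CollectI conjI ballI impI allI)
  fix \<psi> \<omega> assume \<psi>: "\<psi> \<in> A" and \<omega>: "\<omega> \<in> A" and x: "x \<in> chart_dom \<psi> \<inter> chart_dom \<omega>"
  have op: "open (coord \<phi> ` (chart_dom \<phi> \<inter> chart_dom \<psi>))"
    using C1_on_transition[OF assms(1) \<psi>] by (simp add: C1_on_def)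
  have "dir_deriv (transition \<psi> \<omega>) (coord \<psi> x) (dir_deriv (transition \<phi> \<psi>) (coord \<phi> x) u)
    = dir_deriv (\<lambda>p. transition \<psi> \<omega> (transition \<phi> \<psi> p)) (coord \<phi> x) u"
    using dir_deriv_compose[OF C1_on_transition[OF \<psi> \<omega>], of "transition \<phi> \<psi>" "coord \<phi> x" u]
      C1_on_transition[OF assms(1) \<psi>] assms x by (auto simp: transition_coord C1_on_def)
  also have "\<dots> = dir_deriv (transition \<phi> \<omega>) (coord \<phi> x) u"
    using assms \<psi> \<omega> x by (intro dir_deriv_cong[OF op]) (auto simp: transition_coord)
  finally show "tangent_of A \<phi> x u \<omega> = dir_deriv (transition \<psi> \<omega>) (coord \<psi> x) (tangent_of A \<phi> x u \<psi>)"
    using \<psi> \<omega> x by (simp add: tangent_of_def)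
qed (auto simp: tangent_of_def)

lemma tangent_of_eq:
  assumes "\<xi> \<in> tangent_space A x" "\<phi> \<in> A" "x \<in> chart_dom \<phi>"
  shows "tangent_of A \<phi> x (\<xi> \<phi>) = \<xi>"
proof
  fix \<psi>
  show "tangent_of A \<phi> x (\<xi> \<phi>) \<psi> = \<xi> \<psi>"
  proof (cases "\<psi> \<in> A \<and> x \<in> chart_dom \<psi>")
    case True
    then have "\<xi> \<psi> = dir_deriv (transition \<phi> \<psi>) (coord \<phi> x) (\<xi> \<phi>)"
      using assms unfolding tangent_space_def by blast
    then show ?thesis using True by (simp add: tangent_of_def)
  next
    case False
    then have "\<xi> \<psi> = 0"
      using assms(1) unfolding tangent_space_def by blast
    then show ?thesis using False by (auto simp: tangent_of_def)
  qed
qed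

section \<open>The metric in a chart\<close>

lemma metric_local:
  assumes "\<xi> \<in> tangent_space A x" "\<zeta> \<in> tangent_space A x" "\<phi> \<in> A" "x \<in> chart_dom \<phi>"
  shows "\<gamma> x \<xi> \<zeta> = g \<phi> (coord \<phi> x) (\<xi> \<phi>) (\<zeta> \<phi>)"
  using assms by (simp add: local_rep_def chart_inv_coord tangent_of_eq)

lemma bilinear_g: "\<phi> \<in> A \<Longrightarrow> p \<in> chart_im \<phi> \<Longrightarrow> bilinear (g \<phi> p)"
  using metric by (simp add: riemannian_metric_def smooth_tensor2_def)

lemma g_sym: "\<phi> \<in> A \<Longrightarrow> p \<in> chart_im \<phi> \<Longrightarrow> g \<phi> p u v = g \<phi> p v u"
  using metric by (simp add: riemannian_metric_def local_rep_def tangent_of_in_tangent_space chart_inv_in_chart_dom)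

lemma g_pos:
  assumes "\<phi> \<in> A" "p \<in> chart_im \<phi>" "u \<noteq> 0"
  shows "g \<phi> p u u > 0"
proof -
  have "tangent_of A \<phi> (chart_inv \<phi> p) u \<noteq> (\<lambda>_. 0)"
    using tangent_of_self[OF assms(1) chart_inv_in_chart_dom[OF assms(1,2)], of u] assms(3) by auto
  then show ?thesis
    using metric assms
    by (simp add: riemannian_metric_def local_rep_def tangent_of_in_tangent_space chart_inv_in_chart_dom)
qed

lemma g_nonneg: "\<phi> \<in> A \<Longrightarrow> p \<in> chart_im \<phi> \<Longrightarrow> g \<phi> p u u \<ge> 0"
  using g_pos[of \<phi> p u] bilinear_lzero[OF bilinear_g[of \<phi> p]] by (cases "u = 0") auto

lemma g_Cauchy_Schwarz:
  assumes "\<phi> \<in> A" "p \<in> chart_im \<phi>"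
  shows "\<bar>g \<phi> p u v\<bar> \<le> sqrt (g \<phi> p u u) * sqrt (g \<phi> p v v)"
proof (cases "v = 0")
  case True
  then show ?thesis using bilinear_rzero[OF bilinear_g[OF assms]] by simp
next
  case False
  let ?B = "g \<phi> p"
  note b = bilinear_g[OF assms]
  have vv: "?B v v > 0" using g_pos[OF assms False] .
  \<comment> \<open>The component of \<open>u\<close> orthogonal to \<open>v\<close>, multiplied by
    \<open>?B v v\<close> to avoid a division.\<close>
  let ?w = "?B v v *\<^sub>R u - ?B u v *\<^sub>R v"
  have "?B ?w ?w = ?B v v * (?B u u * ?B v v - (?B u v)\<^sup>2)"
    by (simp add: bilinear_lsub[OF b] bilinear_rsub[OF b] bilinear_lmul[OF b] bilinear_rmul[OF b]
        g_sym[OF assms, of v u] power2_eq_square algebra_simps)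
  then have "0 \<le> ?B v v * (?B u u * ?B v v - (?B u v)\<^sup>2)"
    using g_nonneg[OF assms, of ?w] by simp
  then have "(?B u v)\<^sup>2 \<le> ?B u u * ?B v v"
    using vv by (simp add: zero_le_mult_iff)
  then have "\<bar>?B u v\<bar> \<le> sqrt (?B u u * ?B v v)"
    by (simp add: real_le_rsqrt)
  then show ?thesis by (simp add: real_sqrt_mult)
qed

lemma tendsto_g_fixed_base:
  assumes "\<phi> \<in> A" "p \<in> chart_im \<phi>" "(a \<longlongrightarrow> u) F" "(b \<longlongrightarrow> v) F"
  shows "((\<lambda>s. g \<phi> p (a s) (b s)) \<longlongrightarrow> g \<phi> p u v) F"
proof -
  have "isCont (\<lambda>(u, v). g \<phi> p u v) (u, v)"
    using metric assms(1,2) unfolding riemannian_metric_def by (simp add: continuous_on_eq_continuous_at)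
  from isCont_tendsto_compose[OF this tendsto_Pair[OF assms(3,4)]] show ?thesis by simp
qed

lemma smooth_on_g: "\<phi> \<in> A \<Longrightarrow> smooth_on (chart_im \<phi> \<times> UNIV \<times> UNIV) (\<lambda>(p, u, v). g \<phi> p u v)"
  using metric by (simp add: riemannian_metric_def smooth_tensor2_def)

lemma tendsto_g:
  assumes "\<phi> \<in> A" "p \<in> chart_im \<phi>" "(q \<longlongrightarrow> p) F" "(a \<longlongrightarrow> u) F" "(b \<longlongrightarrow> v) F"
  shows "((\<lambda>s. g \<phi> (q s) (a s) (b s)) \<longlongrightarrow> g \<phi> p u v) F"
proof -
  have "isCont (\<lambda>(p, u, v). g \<phi> p u v) (p, u, v)"
    using smooth_on_continuous_on[OF smooth_on_g[OF assms(1)]] assms(1,2) open_chart_im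
    by (auto simp: continuous_on_eq_continuous_at open_Times)
  from isCont_tendsto_compose[OF this tendsto_Pair[OF assms(3) tendsto_Pair[OF assms(4,5)]]]
  show ?thesis by simp
qed

text \<open>The product rule; the base point is moved first, along a segment, so that only the partial
  derivative in the base point enters.\<close>

lemma has_derivative_g:
  assumes \<phi>: "\<phi> \<in> A" "q t \<in> chart_im \<phi>"
    and q: "has_curve_deriv q S t q'" and a: "has_curve_deriv a S t a'" and b: "has_curve_deriv b S t b'"
  shows "((\<lambda>s. g \<phi> (q s) (a s) (b s)) has_real_derivative
     (dir_deriv (\<lambda>p. g \<phi> p (a t) (b t)) (q t) q' + g \<phi> (q t) a' (b t) + g \<phi> (q t) (a t) b')) (at t within S)"
proof -
  let ?F = "at t within S"
  let ?G = "\<lambda>(p, u, v). g \<phi> p u v"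
  let ?k = "\<lambda>s. ((q s - q t) /\<^sub>R (s - t), 0::'e, 0::'e)"
  let ?b = "\<lambda>s. (q t, a s, b s)"
  have d: "filterlim (\<lambda>s. s - t) (at 0) ?F"
    unfolding filterlim_at by (auto simp: eventually_at_filter intro!: tendsto_eq_intros)
  have b0: "(?b \<longlongrightarrow> (q t, a t, b t)) ?F"
    by (intro tendsto_Pair tendsto_const has_curve_deriv_continuous[OF a] has_curve_deriv_continuous[OF b])
  have k0: "(?k \<longlongrightarrow> (q', 0, 0)) ?F"
    using q by (intro tendsto_Pair tendsto_const) (simp add: has_curve_deriv_def)
  have "((\<lambda>s. (?G (?b s + (s - t) *\<^sub>R ?k s) - ?G (?b s)) /\<^sub>R (s - t)) \<longlongrightarrow> dir_deriv ?G (q t, a t, b t) (q', 0, 0)) ?F"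
    using \<phi> by (intro C1_on_tendsto[OF smooth_on_C1_on[OF smooth_on_g[OF \<phi>(1)]] _ b0 k0 d]) auto
  moreover have "dir_deriv ?G (q t, a t, b t) (q', 0, 0) = dir_deriv (\<lambda>p. g \<phi> p (a t) (b t)) (q t) q'"
    by (simp add: dir_deriv_def)
  ultimately have lim1: "((\<lambda>s. (?G (?b s + (s - t) *\<^sub>R ?k s) - ?G (?b s)) /\<^sub>R (s - t))
      \<longlongrightarrow> dir_deriv (\<lambda>p. g \<phi> p (a t) (b t)) (q t) q') ?F" by simp
  have lim2: "((\<lambda>s. g \<phi> (q t) ((a s - a t) /\<^sub>R (s - t)) (b s)) \<longlongrightarrow> g \<phi> (q t) a' (b t)) ?F"
    using a by (intro tendsto_g_fixed_base \<phi> has_curve_deriv_continuous[OF b]) (simp add: has_curve_deriv_def)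
  have lim3: "((\<lambda>s. g \<phi> (q t) (a t) ((b s - b t) /\<^sub>R (s - t))) \<longlongrightarrow> g \<phi> (q t) (a t) b') ?F"
    using b by (intro tendsto_g_fixed_base \<phi> tendsto_const) (simp add: has_curve_deriv_def)
  note bil = bilinear_g[OF \<phi>]
  \<comment> \<open>The three quotients telescope: first the base point moves with
    \<open>a s\<close> and \<open>b s\<close> in place, then the first argument, then the
    second.\<close>
  have "(?G (?b s + (s - t) *\<^sub>R ?k s) - ?G (?b s)) /\<^sub>R (s - t) + g \<phi> (q t) ((a s - a t) /\<^sub>R (s - t)) (b s)
      + g \<phi> (q t) (a t) ((b s - b t) /\<^sub>R (s - t))
    = (g \<phi> (q s) (a s) (b s) - g \<phi> (q t) (a t) (b t)) / (s - t)" if "s \<noteq> t" for s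
  proof -
    let ?g = "g \<phi> (q t)"
    have "?G (?b s + (s - t) *\<^sub>R ?k s) = g \<phi> (q s) (a s) (b s)"
      using that by simp
    then have 1: "(?G (?b s + (s - t) *\<^sub>R ?k s) - ?G (?b s)) /\<^sub>R (s - t)
        = (g \<phi> (q s) (a s) (b s) - ?g (a s) (b s)) / (s - t)"
      by (simp only: case_prod_conv real_scaleR_def divide_inverse_commute)
    have 2: "?g ((a s - a t) /\<^sub>R (s - t)) (b s) = (?g (a s) (b s) - ?g (a t) (b s)) / (s - t)"
      by (simp only: bilinear_lmul[OF bil] bilinear_lsub[OF bil] real_scaleR_def divide_inverse_commute)
    have 3: "?g (a t) ((b s - b t) /\<^sub>R (s - t)) = (?g (a t) (b s) - ?g (a t) (b t)) / (s - t)"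
      by (simp only: bilinear_rmul[OF bil] bilinear_rsub[OF bil] real_scaleR_def divide_inverse_commute)
    show ?thesis
      unfolding 1 2 3 by (simp only: add_divide_distrib[symmetric]) simp
  qed
  then have ev: "eventually (\<lambda>s. (?G (?b s + (s - t) *\<^sub>R ?k s) - ?G (?b s)) /\<^sub>R (s - t) + g \<phi> (q t) ((a s - a t) /\<^sub>R (s - t)) (b s)
      + g \<phi> (q t) (a t) ((b s - b t) /\<^sub>R (s - t))
    = (g \<phi> (q s) (a s) (b s) - g \<phi> (q t) (a t) (b t)) / (s - t)) ?F"
    by (simp add: eventually_at_filter)
  show ?thesis
    unfolding has_field_derivative_iff
    by (rule Lim_transform_eventually[OF tendsto_add[OF tendsto_add[OF lim1 lim2] lim3] ev])
qed

text \<open>Metric compatibility turns the derivative in the base point into two Christoffel terms;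
  these complete \<open>a'\<close> and \<open>b'\<close> to the covariant derivatives along
  \<open>q\<close>.\<close>

lemma has_derivative_g_levi_civita:
  assumes "\<phi> \<in> A" "q t \<in> chart_im \<phi>"
    and "has_curve_deriv q S t q'" and "has_curve_deriv a S t a'" and "has_curve_deriv b S t b'"
  shows "((\<lambda>s. g \<phi> (q s) (a s) (b s)) has_real_derivative
     (g \<phi> (q t) (a' + \<Gamma> \<phi> (q t) q' (a t)) (b t) + g \<phi> (q t) (a t) (b' + \<Gamma> \<phi> (q t) q' (b t)))) (at t within S)"
proof -
  note bil = bilinear_g[OF assms(1,2)]
  have "dir_deriv (\<lambda>p. g \<phi> p (a t) (b t)) (q t) q' =
      g \<phi> (q t) (\<Gamma> \<phi> (q t) q' (a t)) (b t) + g \<phi> (q t) (a t) (\<Gamma> \<phi> (q t) q' (b t))"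
    using levi_civita assms(1,2) unfolding levi_civita_def metric_compatible_def by blast
  then have "dir_deriv (\<lambda>p. g \<phi> p (a t) (b t)) (q t) q' + g \<phi> (q t) a' (b t) + g \<phi> (q t) (a t) b'
     = g \<phi> (q t) (a' + \<Gamma> \<phi> (q t) q' (a t)) (b t) + g \<phi> (q t) (a t) (b' + \<Gamma> \<phi> (q t) q' (b t))"
    by (simp add: bilinear_ladd[OF bil] bilinear_radd[OF bil])
  with has_derivative_g[OF assms] show ?thesis by simp
qed

lemma Christoffel_sym: "\<phi> \<in> A \<Longrightarrow> p \<in> chart_im \<phi> \<Longrightarrow> \<Gamma> \<phi> p u v = \<Gamma> \<phi> p v u"
  using levi_civita by (simp add: levi_civita_def torsion_free_def)

lemma bilinear_Christoffel: "\<phi> \<in> A \<Longrightarrow> p \<in> chart_im \<phi> \<Longrightarrow> bilinear (\<Gamma> \<phi> p)"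
  using levi_civita by (simp add: levi_civita_def connection_def)

section \<open>Velocities of curves\<close>

lemma C1_curve_tendsto: "C1_curve_on A S c \<Longrightarrow> t \<in> S \<Longrightarrow> (c \<longlongrightarrow> c t) (at t within S)"
  by (simp add: C1_curve_on_def continuous_on_def)

lemma C1_curve_has_deriv:
  assumes "C1_curve_on A S c" "t \<in> S" "\<phi> \<in> A" "c t \<in> chart_dom \<phi>"
  shows "has_curve_deriv (\<lambda>s. coord \<phi> (c s)) S t (velocity A S c t \<phi>)"
  using assms unfolding C1_curve_on_def velocity_def by (auto simp: comp_def)

lemma velocity_in_tangent_space:
  assumes "C1_curve_on A S c" "t \<in> S" "at t within S \<noteq> bot"
  shows "velocity A S c t \<in> tangent_space A (c t)"
  unfolding tangent_space_def
proof (intro CollectI conjI ballI impI allI)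
  fix \<psi> \<omega> assume \<psi>: "\<psi> \<in> A" and \<omega>: "\<omega> \<in> A" and x: "c t \<in> chart_dom \<psi> \<inter> chart_dom \<omega>"
  then show "velocity A S c t \<omega> = dir_deriv (transition \<psi> \<omega>) (coord \<psi> (c t)) (velocity A S c t \<psi>)"
    using has_curve_deriv_unique[OF C1_curve_has_deriv[OF assms(1,2) \<omega>] _ assms(3)]
      has_curve_deriv_change_chart[OF \<psi> \<omega> _ _ C1_curve_tendsto[OF assms(1,2)] C1_curve_has_deriv[OF assms(1,2) \<psi>]]
    by blast
qed (auto simp: velocity_def)

lemma C1_curve_tendsto_velocity:
  assumes "C1_curve_on A S c" "t \<in> S" "\<phi> \<in> A" "c t \<in> chart_dom \<phi>"
  shows "((\<lambda>s. velocity A S c s \<phi>) \<longlongrightarrow> velocity A S c t \<phi>) (at t within S)"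
proof -
  let ?v = "curve_deriv (coord \<phi> \<circ> c) S"
  have ev: "eventually (\<lambda>s. c s \<in> chart_dom \<phi>) (at t within S)"
    by (rule eventually_in_chart_dom[OF assms(3) C1_curve_tendsto[OF assms(1,2)] assms(4)])
  have "continuous_on {s \<in> S. c s \<in> chart_dom \<phi>} ?v"
    using assms by (simp add: C1_curve_on_def)
  then have "(?v \<longlongrightarrow> ?v t) (at t within {s \<in> S. c s \<in> chart_dom \<phi>})"
    using assms by (simp add: continuous_on_def)
  then have "(?v \<longlongrightarrow> ?v t) (at t within S)"
    by (simp only: at_within_filter_eq[OF ev])
  moreover have "eventually (\<lambda>s. ?v s = velocity A S c s \<phi>) (at t within S)"
    using ev by eventually_elim (simp add: velocity_def assms)
  ultimately show ?thesis
    using assms by (auto simp: velocity_def intro: Lim_transform_eventually)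
qed

text \<open>Gives the integrability of the speed on each piece of a path. Continuity is local, so
  one chart around \<open>c t\<close> is enough for the parameters near \<open>t\<close>.\<close>

lemma continuous_on_speed:
  assumes c: "C1_curve_on A S c" and S: "\<And>t. t \<in> S \<Longrightarrow> at t within S \<noteq> bot"
  shows "continuous_on S (\<lambda>s. riem_norm \<gamma> (c s) (velocity A S c s))"
  unfolding continuous_on_def
proof
  fix t assume t: "t \<in> S"
  obtain \<phi> where \<phi>: "\<phi> \<in> A" "c t \<in> chart_dom \<phi>" by (rule chart_at)
  let ?v = "\<lambda>s. velocity A S c s"
  have eq: "riem_norm \<gamma> (c s) (?v s) = sqrt (g \<phi> (coord \<phi> (c s)) (?v s \<phi>) (?v s \<phi>))"
    if "s \<in> S" "c s \<in> chart_dom \<phi>" for s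
    using metric_local[OF velocity_in_tangent_space[OF c] velocity_in_tangent_space[OF c] \<phi>(1)] that S
    by (simp add: riem_norm_def)
  have "((\<lambda>s. sqrt (g \<phi> (coord \<phi> (c s)) (?v s \<phi>) (?v s \<phi>))) \<longlongrightarrow> sqrt (g \<phi> (coord \<phi> (c t)) (?v t \<phi>) (?v t \<phi>))) (at t within S)"
    using \<phi> t by (intro tendsto_real_sqrt tendsto_g C1_curve_tendsto_velocity[OF c] tendsto_coord
      C1_curve_tendsto[OF c] coord_in_chart_im)
  moreover have "eventually (\<lambda>s. sqrt (g \<phi> (coord \<phi> (c s)) (?v s \<phi>) (?v s \<phi>)) = riem_norm \<gamma> (c s) (?v s)) (at t within S)"
    using eventually_in_chart_dom[OF \<phi>(1) C1_curve_tendsto[OF c t] \<phi>(2)]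
    unfolding eventually_at_filter by eventually_elim (simp add: eq)
  ultimately show "((\<lambda>s. riem_norm \<gamma> (c s) (?v s)) \<longlongrightarrow> riem_norm \<gamma> (c t) (?v t)) (at t within S)"
    using eq[OF t \<phi>(2)] by (auto intro: Lim_transform_eventually)
qed

section \<open>Geodesics\<close>

lemma at_within_unit_interval: "t \<in> {0..1} \<Longrightarrow> at t within {0..1::real} \<noteq> bot"
  by (simp add: trivial_limit_within islimpt_Icc)

lemma geodesic_C1: "geodesic_on A \<Gamma> S c \<Longrightarrow> C1_curve_on A S c"
  by (simp add: geodesic_on_def)

lemma geodesic_second_deriv:
  assumes "geodesic_on A \<Gamma> S c" "t \<in> S" "\<phi> \<in> A" "c t \<in> chart_dom \<phi>"
  shows "has_curve_deriv (\<lambda>s. velocity A S c s \<phi>) S t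
    (- \<Gamma> \<phi> (coord \<phi> (c t)) (velocity A S c t \<phi>) (velocity A S c t \<phi>))"
proof -
  let ?v = "curve_deriv (coord \<phi> \<circ> c) S"
  have "has_curve_deriv ?v S t (- \<Gamma> \<phi> (coord \<phi> (c t)) (?v t) (?v t))"
    using assms unfolding geodesic_on_def Let_def by blast
  moreover have "eventually (\<lambda>s. ?v s = velocity A S c s \<phi>) (at t within S)"
    using eventually_in_chart_dom[OF assms(3) C1_curve_tendsto[OF geodesic_C1[OF assms(1)] assms(2)] assms(4)]
    by eventually_elim (simp add: velocity_def assms)
  moreover have "?v t = velocity A S c t \<phi>" using assms by (simp add: velocity_def)
  ultimately show ?thesis
    using has_curve_deriv_transform[of ?v S t _ "\<lambda>s. velocity A S c s \<phi>"] by simp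
qed

text \<open>The derivative of the squared speed pairs the velocity with its covariant derivative,
  which the geodesic equation makes 0. The squared speed itself is independent of the chart, so it
  is constant on the whole interval.\<close>

lemma geodesic_constant_speed:
  assumes c: "geodesic_on A \<Gamma> {0..1} c" and "t \<in> {0..1}"
  shows "\<gamma> (c t) (velocity A {0..1} c t) (velocity A {0..1} c t)
    = \<gamma> (c 0) (velocity A {0..1} c 0) (velocity A {0..1} c 0)"
proof -
  let ?v = "velocity A {0..1} c"
  let ?E = "\<lambda>t. \<gamma> (c t) (?v t) (?v t)"
  note C1 = geodesic_C1[OF c]
  have "(?E has_real_derivative 0) (at t within {0..1})" if t: "t \<in> {0..1}" for t
  proof -
    obtain \<phi> where \<phi>: "\<phi> \<in> A" "c t \<in> chart_dom \<phi>" by (rule chart_at)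
    let ?q = "\<lambda>s. coord \<phi> (c s)" and ?w = "\<lambda>s. ?v s \<phi>"
    let ?G = "\<Gamma> \<phi> (?q t) (?w t) (?w t)"
    have im: "?q t \<in> chart_im \<phi>" using \<phi> by (rule coord_in_chart_im)
    have "((\<lambda>s. g \<phi> (?q s) (?w s) (?w s)) has_real_derivative
        (g \<phi> (?q t) (- ?G + ?G) (?w t) + g \<phi> (?q t) (?w t) (- ?G + ?G))) (at t within {0..1})"
      by (intro has_derivative_g_levi_civita \<phi> im C1_curve_has_deriv[OF C1 t] geodesic_second_deriv[OF c t])
    then have "((\<lambda>s. g \<phi> (?q s) (?w s) (?w s)) has_real_derivative 0) (at t within {0..1})"
      using bilinear_lzero[OF bilinear_g[OF \<phi>(1) im]] bilinear_rzero[OF bilinear_g[OF \<phi>(1) im]] by simp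
    moreover have eq: "g \<phi> (?q s) (?w s) (?w s) = ?E s" if "s \<in> {0..1}" "c s \<in> chart_dom \<phi>" for s
      using metric_local[OF velocity_in_tangent_space[OF C1] velocity_in_tangent_space[OF C1] \<phi>(1)] that
        at_within_unit_interval by simp
    moreover have "eventually (\<lambda>s. c s \<in> chart_dom \<phi>) (at t within {0..1})"
      by (rule eventually_in_chart_dom[OF \<phi>(1) C1_curve_tendsto[OF C1 t] \<phi>(2)])
    then have "eventually (\<lambda>s. g \<phi> (?q s) (?w s) (?w s) = ?E s) (at t within {0..1})"
      unfolding eventually_at_filter by eventually_elim (simp add: eq)
    ultimately show ?thesis
      using has_curve_deriv_transform[of "\<lambda>s. g \<phi> (?q s) (?w s) (?w s)" "{0..1}" t 0 ?E] t \<phi>(2)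
      by (simp add: has_curve_deriv_real_iff)
  qed
  then have "\<exists>k. \<forall>t\<in>{0..1}. ?E t = k"
    by (intro has_field_derivative_zero_constant) auto
  then show ?thesis using assms(2) by (metis atLeastAtMost_iff order_refl zero_le_one)
qed

text \<open>Both sides of the geodesic equation are homogeneous of degree two in the velocity:
  \<open>r\<close> enters twice by differentiation and twice through the bilinear
  \<open>\<Gamma>\<close>. The bound \<open>r \<le> 1\<close> keeps \<open>r * s\<close> in the unit
  interval.\<close>

lemma
  assumes c: "geodesic_on A \<Gamma> {0..1} c" and r: "0 < r" "r \<le> 1"
  shows geodesic_rescale: "geodesic_on A \<Gamma> {0..1} (\<lambda>s. c (r * s))"
    and velocity_rescale: "\<And>t \<phi>. t \<in> {0..1} \<Longrightarrow>
      velocity A {0..1} (\<lambda>s. c (r * s)) t \<phi> = r *\<^sub>R velocity A {0..1} c (r * t) \<phi>"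
proof -
  let ?I = "{0..1::real}" and ?d = "\<lambda>s. c (r * s)"
  note C1 = geodesic_C1[OF c]
  have I: "r * t \<in> ?I" if "t \<in> ?I" for t
    using that r mult_le_one[of r t] by auto
  then have sub: "(\<lambda>s. r * s) ` ?I \<subseteq> ?I" by blast
  have der: "has_curve_deriv (\<lambda>s. coord \<phi> (?d s)) ?I t (r *\<^sub>R velocity A ?I c (r * t) \<phi>)"
    if "t \<in> ?I" "\<phi> \<in> A" "?d t \<in> chart_dom \<phi>" for t \<phi>
    using r sub C1_curve_has_deriv[OF C1 I[OF that(1)] that(2,3)]
    by (intro has_curve_deriv_rescale[of "\<lambda>s. coord \<phi> (c s)"]) auto
  have cd: "curve_deriv (coord \<phi> \<circ> ?d) ?I t = r *\<^sub>R velocity A ?I c (r * t) \<phi>"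
    if "t \<in> ?I" "\<phi> \<in> A" "?d t \<in> chart_dom \<phi>" for t \<phi>
    using curve_deriv_eq[OF der[OF that] at_within_unit_interval[OF that(1)]] by (simp add: comp_def)
  then show vel: "velocity A ?I ?d t \<phi> = r *\<^sub>R velocity A ?I c (r * t) \<phi>" if "t \<in> ?I" for t \<phi>
    using that by (auto simp: velocity_def)
  have cont: "continuous_on ?I ?d"
  proof (rule continuous_on_compose2[OF _ _ sub])
    show "continuous_on ?I c" using C1 by (simp add: C1_curve_on_def)
  qed (intro continuous_intros)
  have C1d: "C1_curve_on A ?I ?d"
    unfolding C1_curve_on_def
  proof (intro conjI ballI impI cont)
    fix \<phi> t assume "\<phi> \<in> A" "t \<in> ?I" "?d t \<in> chart_dom \<phi>"
    then show "has_curve_deriv (coord \<phi> \<circ> ?d) ?I t (curve_deriv (coord \<phi> \<circ> ?d) ?I t)"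
      using der[of t \<phi>] by (simp add: cd) (simp add: comp_def)
  next
    fix \<phi> assume \<phi>: "\<phi> \<in> A"
    have "continuous_on {t \<in> ?I. c t \<in> chart_dom \<phi>} (curve_deriv (coord \<phi> \<circ> c) ?I)"
      using C1 \<phi> by (simp add: C1_curve_on_def)
    then have "continuous_on {t \<in> ?I. ?d t \<in> chart_dom \<phi>} (\<lambda>t. curve_deriv (coord \<phi> \<circ> c) ?I (r * t))"
      by (rule continuous_on_compose2) (use I in \<open>auto intro!: continuous_intros\<close>)
    then have "continuous_on {t \<in> ?I. ?d t \<in> chart_dom \<phi>} (\<lambda>t. r *\<^sub>R curve_deriv (coord \<phi> \<circ> c) ?I (r * t))"
      unfolding continuous_on_def by (intro ballI tendsto_scaleR_frechet[OF tendsto_const]) blast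
    then show "continuous_on {t \<in> ?I. ?d t \<in> chart_dom \<phi>} (curve_deriv (coord \<phi> \<circ> ?d) ?I)"
    proof (rule continuous_on_eq)
      fix t assume "t \<in> {t \<in> ?I. ?d t \<in> chart_dom \<phi>}"
      then show "r *\<^sub>R curve_deriv (coord \<phi> \<circ> c) ?I (r * t) = curve_deriv (coord \<phi> \<circ> ?d) ?I t"
        using cd[of t \<phi>] \<phi> by (simp add: velocity_def)
    qed
  qed
  show "geodesic_on A \<Gamma> ?I ?d"
    unfolding geodesic_on_def Let_def
  proof (intro conjI ballI impI C1d)
    fix \<phi> t assume \<phi>: "\<phi> \<in> A" and t: "t \<in> ?I" and dom: "?d t \<in> chart_dom \<phi>"
    let ?w = "velocity A ?I c (r * t) \<phi>" and ?p = "coord \<phi> (?d t)"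
    have "has_curve_deriv (\<lambda>s. velocity A ?I c (r * s) \<phi>) ?I t (r *\<^sub>R (- \<Gamma> \<phi> ?p ?w ?w))"
      using r sub geodesic_second_deriv[OF c I[OF t] \<phi> dom]
      by (intro has_curve_deriv_rescale[of "\<lambda>s. velocity A ?I c s \<phi>"]) auto
    from has_curve_deriv_scaleR_const[OF this, of r]
    have "has_curve_deriv (\<lambda>s. r *\<^sub>R velocity A ?I c (r * s) \<phi>) ?I t (- \<Gamma> \<phi> ?p (r *\<^sub>R ?w) (r *\<^sub>R ?w))"
      using bilinear_Christoffel[OF \<phi> coord_in_chart_im[OF \<phi> dom]]
      by (simp add: bilinear_lmul bilinear_rmul)
    moreover have "eventually (\<lambda>s. ?d s \<in> chart_dom \<phi>) (at t within ?I)"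
      using cont t by (intro eventually_in_chart_dom[OF \<phi> _ dom]) (simp add: continuous_on_def)
    then have "eventually (\<lambda>s. r *\<^sub>R velocity A ?I c (r * s) \<phi> = curve_deriv (coord \<phi> \<circ> ?d) ?I s) (at t within ?I)"
      unfolding eventually_at_filter by eventually_elim (simp add: cd[OF _ \<phi>])
    ultimately show "has_curve_deriv (curve_deriv (coord \<phi> \<circ> ?d) ?I) ?I t
        (- \<Gamma> \<phi> ?p (curve_deriv (coord \<phi> \<circ> ?d) ?I t) (curve_deriv (coord \<phi> \<circ> ?d) ?I t))"
      using cd[OF t \<phi> dom]
        has_curve_deriv_transform[of "\<lambda>s. r *\<^sub>R velocity A ?I c (r * s) \<phi>" ?I t _ "curve_deriv (coord \<phi> \<circ> ?d) ?I"]
      by simp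
  qed
qed

end

section \<open>The exponential mapping at a point\<close>

locale exponential_chart = riemannian_manifold A \<gamma> \<Gamma>
  for A :: "('m::t2_space, 'e::frechet_space) chart set" and \<gamma> \<Gamma> +
  fixes x :: 'm and U :: "('m, 'e) tangent set" and \<phi> :: "('m, 'e) chart"
  assumes zero_in: "(\<lambda>_. 0) \<in> U"
    and exp_domain: "U \<subseteq> exp_domain A \<Gamma> x"
    and diffeo: "tangent_diffeo A x U (exp_map A \<Gamma> x)"
    and chart: "\<phi> \<in> A" "x \<in> chart_dom \<phi>"
begin

text \<open>\<open>W\<close>, \<open>F\<close> and \<open>V\<close> are the domain \<open>U\<close>,
  the exponential mapping and its inverse, with the tangent space at \<open>x\<close> identified
  with the model space by the linear coordinate of \<open>\<phi>\<close>.\<close>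

definition W :: "'e set" where "W = (\<lambda>\<xi>. \<xi> \<phi>) ` U"

definition F :: "'e \<Rightarrow> 'm" where "F u = exp_map A \<Gamma> x (tangent_of A \<phi> x u)"

definition V :: "'m \<Rightarrow> 'e" where "V y = inv_into U (exp_map A \<Gamma> x) y \<phi>"

text \<open>\<open>SOME\<close> and not \<open>THE\<close>: a geodesic is determined on the unit
  interval only and is arbitrary elsewhere.\<close>

definition geo :: "'e \<Rightarrow> real \<Rightarrow> 'm" where
  "geo u = (SOME c. geodesic_from A \<Gamma> x (tangent_of A \<phi> x u) c)"

abbreviation f :: "('m, 'e) chart \<Rightarrow> 'e \<Rightarrow> 'e" where "f \<psi> \<equiv> \<lambda>u. coord \<psi> (F u)"

abbreviation B :: "'e \<Rightarrow> 'e \<Rightarrow> real" where "B \<equiv> g \<phi> (coord \<phi> x)"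

lemma center_in_chart_im: "coord \<phi> x \<in> chart_im \<phi>"
  using chart by (rule coord_in_chart_im)

lemma U_tangent: "\<xi> \<in> U \<Longrightarrow> \<xi> \<in> tangent_space A x"
  using exp_domain unfolding exp_domain_def by blast

lemma W_iff: "u \<in> W \<longleftrightarrow> tangent_of A \<phi> x u \<in> U"
proof
  assume "u \<in> W"
  then obtain \<xi> where "\<xi> \<in> U" "u = \<xi> \<phi>" by (auto simp: W_def)
  then show "tangent_of A \<phi> x u \<in> U"
    using tangent_of_eq[OF U_tangent chart] by simp
next
  assume "tangent_of A \<phi> x u \<in> U"
  then show "u \<in> W"
    unfolding W_def using tangent_of_self[OF chart] by (metis imageI)
qed

lemma open_W: "open W"
  using diffeo chart unfolding tangent_diffeo_def open_in_tangent_space_def W_def by blast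

lemma zero_in_W: "0 \<in> W"
  using zero_in unfolding W_def by (metis imageI)

lemma bij_exp: "bij_betw (exp_map A \<Gamma> x) U UNIV"
  using diffeo by (simp add: tangent_diffeo_def)

lemma inv_exp_in: "inv_into U (exp_map A \<Gamma> x) y \<in> U"
  using bij_exp by (simp add: bij_betw_def inv_into_into)

lemma V_in_W: "V y \<in> W"
  using inv_exp_in unfolding W_def V_def by blast

lemma F_V: "F (V y) = y"
  using tangent_of_eq[OF U_tangent[OF inv_exp_in] chart, of y] bij_exp
  by (simp add: F_def V_def bij_betw_def f_inv_into_f)

lemma V_F: "u \<in> W \<Longrightarrow> V (F u) = u"
  using bij_exp by (simp add: F_def V_def W_iff bij_betw_def tangent_of_self[OF chart])

lemma
  assumes "\<psi> \<in> A"
  shows smooth_on_F: "smooth_on (W \<inter> F -` chart_dom \<psi>) (f \<psi>)"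
    and smooth_on_V: "smooth_on (chart_im \<psi>) (\<lambda>p. V (chart_inv \<psi> p))"
  using diffeo chart assms
  unfolding tangent_diffeo_def Let_def W_def F_def[abs_def] V_def comp_def by blast+

lemma C1_on_F: "\<psi> \<in> A \<Longrightarrow> C1_on (W \<inter> F -` chart_dom \<psi>) (f \<psi>)"
  by (rule smooth_on_C1_on[OF smooth_on_F])

lemma C1_on_dF:
  "\<psi> \<in> A \<Longrightarrow> C1_on (W \<inter> F -` chart_dom \<psi>) (\<lambda>y. dir_deriv (f \<psi>) y h)"
  by (rule smooth_on_C1_on[OF smooth_on_dir_deriv[OF smooth_on_F]])

text \<open>Smoothness of the inverse exponential mapping enters here. It makes \<open>V\<close>
  continuous along geodesics and the squared radius differentiable along paths.\<close>

lemma V_curve_deriv: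
  assumes "C1_curve_on A S c" "t \<in> S" "\<psi> \<in> A" "c t \<in> chart_dom \<psi>"
  shows "has_curve_deriv (\<lambda>s. V (c s)) S t
    (dir_deriv (\<lambda>p. V (chart_inv \<psi> p)) (coord \<psi> (c t)) (velocity A S c t \<psi>))"
proof (rule has_curve_deriv_transform)
  show "has_curve_deriv (\<lambda>s. V (chart_inv \<psi> (coord \<psi> (c s)))) S t
    (dir_deriv (\<lambda>p. V (chart_inv \<psi> p)) (coord \<psi> (c t)) (velocity A S c t \<psi>))"
    using assms by (intro C1_on_chain[OF smooth_on_C1_on[OF smooth_on_V]] C1_curve_has_deriv coord_in_chart_im)
  show "eventually (\<lambda>s. V (chart_inv \<psi> (coord \<psi> (c s))) = V (c s)) (at t within S)"
    using eventually_in_chart_dom[OF assms(3) C1_curve_tendsto[OF assms(1,2)] assms(4)]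
    by eventually_elim (simp add: chart_inv_coord assms)
qed (simp add: chart_inv_coord assms)

section \<open>Radial geodesics\<close>

lemma geo_geodesic:
  assumes "u \<in> W"
  shows "geodesic_from A \<Gamma> x (tangent_of A \<phi> x u) (geo u)"
proof -
  have "\<exists>c. geodesic_from A \<Gamma> x (tangent_of A \<phi> x u) c"
    using assms exp_domain unfolding W_iff exp_domain_def by blast
  then show ?thesis unfolding geo_def by (rule someI_ex)
qed

lemma geo_unique:
  assumes "u \<in> W" "geodesic_from A \<Gamma> x (tangent_of A \<phi> x u) c" "t \<in> {0..1}"
  shows "geo u t = c t"
  using assms exp_domain geo_geodesic[OF assms(1)] unfolding W_iff exp_domain_def by blast

lemma F_geo:
  assumes "u \<in> W"
  shows "F u = geo u 1"
  unfolding F_def exp_map_def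
proof (rule the_equality)
  show "\<exists>c. geodesic_from A \<Gamma> x (tangent_of A \<phi> x u) c \<and> c 1 = geo u 1"
    using geo_geodesic[OF assms] by blast
  show "y = geo u 1" if "\<exists>c. geodesic_from A \<Gamma> x (tangent_of A \<phi> x u) c \<and> c 1 = y" for y
    using that geo_unique[OF assms, of _ 1] by auto
qed

lemma
  assumes "u \<in> W"
  shows geo_is_geodesic: "geodesic_on A \<Gamma> {0..1} (geo u)"
    and geo_0: "geo u 0 = x"
    and geo_velocity_0: "velocity A {0..1} (geo u) 0 = tangent_of A \<phi> x u"
  using geo_geodesic[OF assms] by (auto simp: geodesic_from_def)

text \<open>The rescaled geodesic starts with velocity \<open>r *\<^sub>R u\<close>, and uniqueness
  identifies it with \<open>geo (r *\<^sub>R u)\<close>. Uniqueness is available for vectors in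
  \<open>W\<close> only, hence the last premise, which \<open>star_shaped\<close> will
  supply.\<close>

lemma F_scale:
  assumes "u \<in> W" "0 < r" "r \<le> 1" "r *\<^sub>R u \<in> W"
  shows "F (r *\<^sub>R u) = geo u r"
proof -
  let ?d = "\<lambda>s. geo u (r * s)" and ?I = "{0..1::real}"
  have geod: "geodesic_on A \<Gamma> ?I ?d"
    using assms by (intro geodesic_rescale geo_is_geodesic)
  have d0: "?d 0 = x" using assms by (simp add: geo_0)
  have "velocity A ?I ?d 0 \<phi> = r *\<^sub>R u"
    using velocity_rescale[OF geo_is_geodesic[OF assms(1)] assms(2,3), of 0 \<phi>]
    by (simp add: geo_velocity_0 assms tangent_of_self chart)
  moreover have "velocity A ?I ?d 0 \<in> tangent_space A x"
    using velocity_in_tangent_space[OF geodesic_C1[OF geod], of 0] at_within_unit_interval[of 0] d0 by simp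
  ultimately have "velocity A ?I ?d 0 = tangent_of A \<phi> x (r *\<^sub>R u)"
    using tangent_of_eq[OF _ chart] by metis
  then have "geodesic_from A \<Gamma> x (tangent_of A \<phi> x (r *\<^sub>R u)) ?d"
    using geod d0 by (simp add: geodesic_from_def)
  from geo_unique[OF assms(4) this, of 1] show ?thesis
    by (simp add: F_geo assms)
qed

text \<open>By \<open>F_scale\<close>, \<open>geo 0\<close> has the constant value
  \<open>F 0\<close> at all positive times; continuity at time 0 forces this value to be
  \<open>x\<close>.\<close>

lemma F_0: "F 0 = x"
proof -
  note W0 = zero_in_W
  have "(geo 0 \<longlongrightarrow> x) (at 0 within {0..1})"
    using C1_curve_tendsto[OF geodesic_C1[OF geo_is_geodesic[OF W0]], of 0] geo_0[OF W0] by simp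
  moreover have "geo 0 t = F 0" if "t \<in> {0..1}" "t \<noteq> 0" for t
    using F_scale[OF W0, of t] W0 that by simp
  then have "eventually (\<lambda>t. geo 0 t = F 0) (at 0 within {0..1})"
    unfolding eventually_at_filter by (intro always_eventually) blast
  ultimately have "((\<lambda>_. F 0) \<longlongrightarrow> x) (at 0 within {0..1::real})"
    by (rule Lim_transform_eventually)
  then show ?thesis
    using tendsto_unique[OF at_within_unit_interval[of 0] tendsto_const] by auto
qed

text \<open>Since \<open>V\<close> is continuous and takes values in \<open>W\<close>, the set of \<open>t\<close> with \<open>V (geo u t) = t *\<^sub>R u\<close>
  is closed; it is also open, as it consists of the \<open>t\<close> with \<open>t *\<^sub>R u \<in> W\<close>. So \<open>W\<close> is star-shaped.\<close>

lemma
  assumes u: "u \<in> W" and t: "t \<in> {0..1}"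
  shows star_shaped: "t *\<^sub>R u \<in> W" and geo_F: "geo u t = F (t *\<^sub>R u)"
proof -
  let ?I = "{0..1::real}"
  define Z where "Z = {t \<in> ?I. V (geo u t) - t *\<^sub>R u = 0}"
  note C1 = geodesic_C1[OF geo_is_geodesic[OF u]]
  have Z_eq: "Z = ?I \<inter> (\<lambda>t. t *\<^sub>R u) -` W"
  proof (intro set_eqI iffI)
    fix t assume "t \<in> Z"
    then show "t \<in> ?I \<inter> (\<lambda>t. t *\<^sub>R u) -` W"
      using V_in_W[of "geo u t"] by (auto simp: Z_def)
  next
    fix t assume *: "t \<in> ?I \<inter> (\<lambda>t. t *\<^sub>R u) -` W"
    have "geo u t = F (t *\<^sub>R u)"
      using * F_scale[OF u, of t] F_0 geo_0[OF u] by (cases "t = 0") auto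
    then show "t \<in> Z" using * V_F by (simp add: Z_def)
  qed
  have cont2: "continuous_on ?I (\<lambda>t. t *\<^sub>R u)"
    unfolding continuous_on_def by (intro ballI tendsto_scaleR_frechet tendsto_ident_at tendsto_const)
  have "((\<lambda>s. V (geo u s)) \<longlongrightarrow> V (geo u t)) (at t within ?I)" if "t \<in> ?I" for t
    using chart_at[of "geo u t"] has_curve_deriv_continuous[OF V_curve_deriv[OF C1 that]] by metis
  then have cont1: "continuous_on ?I (\<lambda>t. V (geo u t) - t *\<^sub>R u)"
    unfolding continuous_on_def
    by (intro ballI tendsto_diff tendsto_scaleR_frechet tendsto_ident_at tendsto_const)
  have "closedin (top_of_set ?I) Z"
    unfolding Z_def by (rule continuous_closedin_preimage_constant[OF cont1])
  moreover have "openin (top_of_set ?I) Z"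
    unfolding Z_eq by (rule continuous_openin_preimage_gen[OF cont2 open_W])
  moreover have "0 \<in> Z" unfolding Z_eq by (simp add: zero_in_W)
  ultimately have "Z = ?I"
    using connected_clopen[of ?I] connected_Icc[of "0::real" 1] by (metis empty_iff)
  then have "t \<in> Z" using t by simp
  then show W: "t *\<^sub>R u \<in> W" unfolding Z_eq by simp
  from \<open>t \<in> Z\<close> show "geo u t = F (t *\<^sub>R u)"
    using F_V[of "geo u t"] by (simp add: Z_def)
qed

section \<open>Derivatives of the exponential mapping along rays\<close>

lemma geo_velocity:
  assumes \<psi>: "\<psi> \<in> A" and "u \<in> W" "t \<in> {0..1}" "F (t *\<^sub>R u) \<in> chart_dom \<psi>"
  shows "velocity A {0..1} (geo u) t \<psi> = dir_deriv (f \<psi>) (t *\<^sub>R u) u"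
proof (rule has_curve_deriv_unique)
  show "has_curve_deriv (\<lambda>s. coord \<psi> (geo u s)) {0..1} t (velocity A {0..1} (geo u) t \<psi>)"
    using C1_curve_has_deriv[OF geodesic_C1[OF geo_is_geodesic[OF assms(2)]] assms(3) \<psi>] assms
    by (simp add: geo_F)
  show "has_curve_deriv (\<lambda>s. coord \<psi> (geo u s)) {0..1} t (dir_deriv (f \<psi>) (t *\<^sub>R u) u)"
  proof (rule has_curve_deriv_transform)
    show "has_curve_deriv (\<lambda>s. f \<psi> (s *\<^sub>R u)) {0..1} t (dir_deriv (f \<psi>) (t *\<^sub>R u) u)"
      using assms star_shaped
      by (intro C1_on_chain[OF C1_on_F[OF \<psi>], of "\<lambda>s. s *\<^sub>R u"] has_curve_deriv_id_scaleR) auto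
    show "eventually (\<lambda>s. f \<psi> (s *\<^sub>R u) = coord \<psi> (geo u s)) (at t within {0..1})"
      unfolding eventually_at_filter by (intro always_eventually) (simp add: geo_F assms)
  qed (use assms in \<open>simp add: geo_F\<close>)
  show "at t within {0..1} \<noteq> bot" by (rule at_within_unit_interval[OF assms(3)])
qed

lemma geo_acceleration:
  assumes \<psi>: "\<psi> \<in> A" and "u \<in> W" "t \<in> {0..1}" "F (t *\<^sub>R u) \<in> chart_dom \<psi>"
  shows "has_curve_deriv (\<lambda>s. dir_deriv (f \<psi>) (s *\<^sub>R u) u) {0..1} t
    (- \<Gamma> \<psi> (f \<psi> (t *\<^sub>R u)) (dir_deriv (f \<psi>) (t *\<^sub>R u) u) (dir_deriv (f \<psi>) (t *\<^sub>R u) u))"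
proof (rule has_curve_deriv_transform)
  note C1 = geodesic_C1[OF geo_is_geodesic[OF assms(2)]]
  have dom: "geo u t \<in> chart_dom \<psi>" using assms by (simp add: geo_F)
  show "has_curve_deriv (\<lambda>s. velocity A {0..1} (geo u) s \<psi>) {0..1} t
    (- \<Gamma> \<psi> (f \<psi> (t *\<^sub>R u)) (dir_deriv (f \<psi>) (t *\<^sub>R u) u) (dir_deriv (f \<psi>) (t *\<^sub>R u) u))"
    using geodesic_second_deriv[OF geo_is_geodesic[OF assms(2)] assms(3) \<psi> dom] assms
    by (simp add: geo_velocity geo_F)
  have "eventually (\<lambda>s. geo u s \<in> chart_dom \<psi>) (at t within {0..1})"
    by (rule eventually_in_chart_dom[OF \<psi> C1_curve_tendsto[OF C1 assms(3)] dom])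
  then show "eventually (\<lambda>s. velocity A {0..1} (geo u) s \<psi> = dir_deriv (f \<psi>) (s *\<^sub>R u) u) (at t within {0..1})"
    unfolding eventually_at_filter by eventually_elim (simp add: geo_velocity geo_F assms)
qed (use assms in \<open>simp add: geo_velocity\<close>)

text \<open>The constant speed of \<open>geo u\<close>, evaluated at time 0, where the velocity is
  \<open>u\<close>. As it holds for all \<open>u\<close> in the open set \<open>W\<close>, both
  sides can be differentiated in \<open>u\<close>.\<close>

lemma radial_speed:
  assumes \<psi>: "\<psi> \<in> A" and "u \<in> W" "t \<in> {0..1}" "F (t *\<^sub>R u) \<in> chart_dom \<psi>"
  shows "g \<psi> (f \<psi> (t *\<^sub>R u)) (dir_deriv (f \<psi>) (t *\<^sub>R u) u) (dir_deriv (f \<psi>) (t *\<^sub>R u) u) = B u u"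
proof -
  let ?v = "velocity A {0..1} (geo u)"
  note geod = geo_is_geodesic[OF assms(2)]
  have v: "?v t \<in> tangent_space A (geo u t)"
    using velocity_in_tangent_space[OF geodesic_C1[OF geod] assms(3) at_within_unit_interval[OF assms(3)]] .
  have "g \<psi> (f \<psi> (t *\<^sub>R u)) (dir_deriv (f \<psi>) (t *\<^sub>R u) u) (dir_deriv (f \<psi>) (t *\<^sub>R u) u) = \<gamma> (geo u t) (?v t) (?v t)"
    using metric_local[OF v v \<psi>] assms by (simp add: geo_velocity geo_F)
  also have "\<dots> = \<gamma> (geo u 0) (?v 0) (?v 0)"
    by (rule geodesic_constant_speed[OF geod assms(3)])
  also have "\<dots> = B u u"
    using metric_local[OF tangent_of_in_tangent_space[OF chart] tangent_of_in_tangent_space[OF chart] chart]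
    by (simp add: geo_0 geo_velocity_0 assms tangent_of_self chart)
  finally show ?thesis .
qed

text \<open>The right-hand side is half the derivative of the squared speed \<open>B (u + s w) (u + s w)\<close> of the
  radial geodesics; the left-hand side appears after exchanging \<open>s\<close>- and \<open>t\<close>-derivatives.\<close>

lemma energy_variation:
  fixes u w :: 'e and t :: real
  assumes \<psi>: "\<psi> \<in> A" and u: "u \<in> W" and t: "t \<in> {0..1}" and dom: "F (t *\<^sub>R u) \<in> chart_dom \<psi>"
  defines "X \<equiv> dir_deriv (f \<psi>) (t *\<^sub>R u) u" and "Y \<equiv> dir_deriv (f \<psi>) (t *\<^sub>R u) w"
    and "Z \<equiv> dir_deriv (\<lambda>y. dir_deriv (f \<psi>) y w) (t *\<^sub>R u) u"
  shows "g \<psi> (f \<psi> (t *\<^sub>R u)) X (Y + t *\<^sub>R Z + \<Gamma> \<psi> (f \<psi> (t *\<^sub>R u)) X (t *\<^sub>R Y)) = B u w"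
proof -
  let ?D = "W \<inter> F -` chart_dom \<psi>"
  let ?p = "f \<psi> (t *\<^sub>R u)"
  \<comment> \<open>\<open>?y s\<close> is \<open>t *\<^sub>R (u + s *\<^sub>R w)\<close>. By
    linearity \<open>?P s\<close> is the velocity at time \<open>t\<close> of the radial geodesic
    with initial velocity \<open>u + s *\<^sub>R w\<close>, expanded so that the rules for curves
    apply.\<close>
  let ?y = "\<lambda>s. t *\<^sub>R u + s *\<^sub>R (t *\<^sub>R w)"
  let ?P = "\<lambda>s. dir_deriv (f \<psi>) (?y s) u + s *\<^sub>R dir_deriv (f \<psi>) (?y s) w"
  have tu: "t *\<^sub>R u \<in> ?D" using star_shaped[OF u t] dom by simp
  have im: "?p \<in> chart_im \<psi>" using dom by (intro coord_in_chart_im \<psi>) simp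
  have y: "has_curve_deriv ?y UNIV 0 (t *\<^sub>R w)"
    using has_curve_deriv_add[OF has_curve_deriv_const[of "t *\<^sub>R u" UNIV 0] has_curve_deriv_id_scaleR[of "t *\<^sub>R w" UNIV 0]]
    by simp
  have Q': "has_curve_deriv (\<lambda>s. f \<psi> (?y s)) UNIV 0 (t *\<^sub>R Y)"
    using C1_on_chain[OF C1_on_F[OF \<psi>], of ?y 0, OF _ y] tu
    by (simp add: Y_def dir_deriv_scaleR[OF C1_on_F[OF \<psi>] tu])
  \<comment> \<open>Here the direction \<open>u\<close> is differentiated first and \<open>w\<close>
    second; symmetry of second derivatives gives \<open>Z\<close>, where the order is
    reversed.\<close>
  have "has_curve_deriv (\<lambda>s. dir_deriv (f \<psi>) (?y s) u) UNIV 0 (t *\<^sub>R Z)"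
    using C1_on_chain[OF C1_on_dF[OF \<psi>], of ?y 0, OF _ y] tu
    by (simp add: Z_def dir_deriv_scaleR[OF C1_on_dF[OF \<psi>] tu]
        dir_deriv_symmetric[OF C1_on_F[OF \<psi>] C1_on_dF[OF \<psi>] tu, of w u])
  moreover have "has_curve_deriv (\<lambda>s. s *\<^sub>R dir_deriv (f \<psi>) (?y s) w) UNIV 0 Y"
    using has_curve_deriv_id_mult[OF C1_on_chain[OF C1_on_dF[OF \<psi>], of ?y 0, OF _ y]] tu
    by (simp add: Y_def)
  ultimately have P': "has_curve_deriv ?P UNIV 0 (t *\<^sub>R Z + Y)"
    by (rule has_curve_deriv_add)
  have P0: "?P 0 = X" by (simp add: X_def)
  have "((\<lambda>s. g \<psi> (f \<psi> (?y s)) (?P s) (?P s)) has_real_derivative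
      (g \<psi> (f \<psi> (?y 0)) (t *\<^sub>R Z + Y + \<Gamma> \<psi> (f \<psi> (?y 0)) (t *\<^sub>R Y) (?P 0)) (?P 0) +
       g \<psi> (f \<psi> (?y 0)) (?P 0) (t *\<^sub>R Z + Y + \<Gamma> \<psi> (f \<psi> (?y 0)) (t *\<^sub>R Y) (?P 0)))) (at 0 within UNIV)"
    using im by (intro has_derivative_g_levi_civita[OF \<psi> _ Q' P' P']) simp
  \<comment> \<open>Torsion-freeness exchanges the arguments of \<open>\<Gamma>\<close>. The
    derivative of the velocity along the variation thereby becomes the covariant derivative of the
    variation field along the ray.\<close>
  then have 1: "((\<lambda>s. g \<psi> (f \<psi> (?y s)) (?P s) (?P s)) has_real_derivative
      2 * g \<psi> ?p X (Y + t *\<^sub>R Z + \<Gamma> \<psi> ?p X (t *\<^sub>R Y))) (at 0)"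
    unfolding P0 by (simp add: g_sym[OF \<psi> im, of _ X] Christoffel_sym[OF \<psi> im, of "t *\<^sub>R Y" X] add.commute)
  let ?z = "\<lambda>s. u + s *\<^sub>R w"
  have z: "has_curve_deriv ?z UNIV 0 w"
    using has_curve_deriv_add[OF has_curve_deriv_const[of u UNIV 0] has_curve_deriv_id_scaleR[of w UNIV 0]] by simp
  have "((\<lambda>s. B (?z s) (?z s)) has_real_derivative
     (dir_deriv (\<lambda>p. g \<phi> p (?z 0) (?z 0)) (coord \<phi> x) 0 + B w (?z 0) + B (?z 0) w)) (at 0 within UNIV)"
    by (intro has_derivative_g[OF chart(1) center_in_chart_im has_curve_deriv_const z z])
  then have 2: "((\<lambda>s. B (?z s) (?z s)) has_real_derivative 2 * B u w) (at 0)"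
    using g_sym[OF chart(1) center_in_chart_im, of w u] by (simp add: dir_deriv_zero)
  have "eventually (\<lambda>s. ?y s \<in> ?D) (at 0)"
    using C1_on_F[OF \<psi>] tu by (intro topological_tendstoD[OF tendsto_along_line]) (auto simp: C1_on_def)
  moreover have "eventually (\<lambda>s. ?z s \<in> W) (at 0)"
    by (rule topological_tendstoD[OF tendsto_along_line open_W u])
  ultimately have ev: "eventually (\<lambda>s. g \<psi> (f \<psi> (?y s)) (?P s) (?P s) = B (?z s) (?z s)) (at 0)"
  proof eventually_elim
    case (elim s)
    have eq: "t *\<^sub>R ?z s = ?y s" by (simp add: algebra_simps)
    have P: "dir_deriv (f \<psi>) (?y s) (?z s) = ?P s"
      using dir_deriv_add[OF C1_on_F[OF \<psi>] elim(1), of u "s *\<^sub>R w"]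
        dir_deriv_scaleR[OF C1_on_F[OF \<psi>] elim(1), of s w] by (simp only:)
    have "F (t *\<^sub>R ?z s) \<in> chart_dom \<psi>" using elim(1) unfolding eq by blast
    from radial_speed[OF \<psi> elim(2) t this] show ?case
      by (simp only: eq P)
  qed
  have "g \<psi> (f \<psi> (?y 0)) (?P 0) (?P 0) = B (?z 0) (?z 0)"
    using radial_speed[OF \<psi> u t dom] by simp
  then have "((\<lambda>s. B (?z s) (?z s)) has_real_derivative
      2 * g \<psi> ?p X (Y + t *\<^sub>R Z + \<Gamma> \<psi> ?p X (t *\<^sub>R Y))) (at 0)"
    using has_curve_deriv_transform[of "\<lambda>s. g \<psi> (f \<psi> (?y s)) (?P s) (?P s)" UNIV 0 _ "\<lambda>s. B (?z s) (?z s)"] ev 1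
    unfolding has_curve_deriv_real_iff by blast
  from DERIV_unique[OF this 2] show ?thesis by simp
qed

text \<open>Let \<open>a t\<close> be the product of the radial velocity with the variation field
  \<open>J t\<close>. In its derivative the acceleration term vanishes, and
  \<open>energy_variation\<close> evaluates the other term as \<open>B u w\<close>. Since
  \<open>a 0 = 0\<close>, integrating up to time 1 gives the claim.\<close>

lemma Gauss_lemma:
  assumes u: "u \<in> W" and \<psi>: "\<psi> \<in> A" and dom: "F u \<in> chart_dom \<psi>"
  shows "g \<psi> (f \<psi> u) (dir_deriv (f \<psi>) u u) (dir_deriv (f \<psi>) u w) = B u w"
proof -
  let ?I = "{0..1::real}"
  \<comment> \<open>Given in all charts at once, since the ray may cross several; \<open>a\<close>
    is then one function on the whole interval.\<close>
  define J where "J t = (\<lambda>\<psi>. if \<psi> \<in> A \<and> F (t *\<^sub>R u) \<in> chart_dom \<psi> then dir_deriv (f \<psi>) (t *\<^sub>R u) (t *\<^sub>R w) else 0)" for t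
  define a where "a t = \<gamma> (F (t *\<^sub>R u)) (velocity A ?I (geo u) t) (J t)" for t
  note geod = geo_is_geodesic[OF u]
  have J: "J t \<in> tangent_space A (F (t *\<^sub>R u))" if t: "t \<in> ?I" for t
    unfolding tangent_space_def
  proof (intro CollectI conjI ballI impI allI)
    fix \<psi> \<omega> assume A: "\<psi> \<in> A" "\<omega> \<in> A" and d: "F (t *\<^sub>R u) \<in> chart_dom \<psi> \<inter> chart_dom \<omega>"
    let ?y = "t *\<^sub>R u"
    let ?D = "(W \<inter> F -` chart_dom \<psi>) \<inter> (W \<inter> F -` chart_dom \<omega>)"
    have y: "?y \<in> ?D" using star_shaped[OF u t] d by simp
    have op: "open ?D" using C1_on_F[OF A(1)] C1_on_F[OF A(2)] by (auto simp: C1_on_def)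
    have "dir_deriv (f \<omega>) ?y (t *\<^sub>R w) = dir_deriv (\<lambda>v. transition \<psi> \<omega> (f \<psi> v)) ?y (t *\<^sub>R w)"
      by (rule dir_deriv_cong[OF op y]) (simp add: transition_coord A)
    also have "\<dots> = dir_deriv (transition \<psi> \<omega>) (f \<psi> ?y) (dir_deriv (f \<psi>) ?y (t *\<^sub>R w))"
      using y C1_on_F[OF A(1)] by (intro dir_deriv_compose[OF C1_on_transition[OF A]]) (auto simp: C1_on_def)
    finally show "J t \<omega> = dir_deriv (transition \<psi> \<omega>) (coord \<psi> (F ?y)) (J t \<psi>)"
      using A d by (simp add: J_def)
  qed (auto simp: J_def)
  have a_local: "a t = g \<psi> (f \<psi> (t *\<^sub>R u)) (dir_deriv (f \<psi>) (t *\<^sub>R u) u) (t *\<^sub>R dir_deriv (f \<psi>) (t *\<^sub>R u) w)"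
    if t: "t \<in> ?I" and \<psi>: "\<psi> \<in> A" and d: "F (t *\<^sub>R u) \<in> chart_dom \<psi>" for t \<psi>
  proof -
    have "velocity A ?I (geo u) t \<in> tangent_space A (F (t *\<^sub>R u))"
      using velocity_in_tangent_space[OF geodesic_C1[OF geod] t at_within_unit_interval[OF t]] by (simp add: geo_F u t[simplified])
    from metric_local[OF this J[OF t] \<psi> d] show ?thesis
      using dir_deriv_scaleR[OF C1_on_F[OF \<psi>], of "t *\<^sub>R u" t w] star_shaped[OF u t] d \<psi>
      by (simp add: a_def J_def geo_velocity[OF \<psi> u t d])
  qed
  have "((\<lambda>t. a t - t * B u w) has_real_derivative 0) (at t within ?I)" if t: "t \<in> ?I" for t
  proof -
    obtain \<psi> where \<psi>: "\<psi> \<in> A" and d: "F (t *\<^sub>R u) \<in> chart_dom \<psi>" by (rule chart_at)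
    let ?D = "W \<inter> F -` chart_dom \<psi>"
    have tu: "t *\<^sub>R u \<in> ?D" using star_shaped[OF u t] d by simp
    let ?p = "f \<psi> (t *\<^sub>R u)" and ?X = "dir_deriv (f \<psi>) (t *\<^sub>R u) u" and ?Y = "dir_deriv (f \<psi>) (t *\<^sub>R u) w"
    let ?Z = "dir_deriv (\<lambda>y. dir_deriv (f \<psi>) y w) (t *\<^sub>R u) u"
    have im: "?p \<in> chart_im \<psi>" using coord_in_chart_im[OF \<psi> d] by simp
    have q: "has_curve_deriv (\<lambda>s. f \<psi> (s *\<^sub>R u)) ?I t ?X"
      using tu by (intro C1_on_chain[OF C1_on_F[OF \<psi>], of "\<lambda>s. s *\<^sub>R u"] has_curve_deriv_id_scaleR)
    have X: "has_curve_deriv (\<lambda>s. dir_deriv (f \<psi>) (s *\<^sub>R u) u) ?I t (- \<Gamma> \<psi> ?p ?X ?X)"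
      using geo_acceleration[OF \<psi> u t d] by simp
    have "has_curve_deriv (\<lambda>s. dir_deriv (f \<psi>) (s *\<^sub>R u) w) ?I t ?Z"
      using tu C1_on_dF[OF \<psi>, of w]
      by (intro C1_on_chain[of ?D "\<lambda>y. dir_deriv (f \<psi>) y w" "\<lambda>s. s *\<^sub>R u"] has_curve_deriv_id_scaleR)
    then have Y: "has_curve_deriv (\<lambda>s. s *\<^sub>R dir_deriv (f \<psi>) (s *\<^sub>R u) w) ?I t (?Y + t *\<^sub>R ?Z)"
      by (rule has_curve_deriv_id_mult)
    let ?h = "\<lambda>s. g \<psi> (f \<psi> (s *\<^sub>R u)) (dir_deriv (f \<psi>) (s *\<^sub>R u) u) (s *\<^sub>R dir_deriv (f \<psi>) (s *\<^sub>R u) w)"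
    have "(?h has_real_derivative
      (g \<psi> ?p (- \<Gamma> \<psi> ?p ?X ?X + \<Gamma> \<psi> ?p ?X ?X) (t *\<^sub>R ?Y) +
       g \<psi> ?p ?X (?Y + t *\<^sub>R ?Z + \<Gamma> \<psi> ?p ?X (t *\<^sub>R ?Y)))) (at t within ?I)"
      by (rule has_derivative_g_levi_civita[OF \<psi> im q X Y])
    moreover have "g \<psi> ?p ?X (?Y + t *\<^sub>R ?Z + \<Gamma> \<psi> ?p ?X (t *\<^sub>R ?Y)) = B u w"
      using energy_variation[OF \<psi> u t d, of w] by simp
    ultimately have "(?h has_real_derivative B u w) (at t within ?I)"
      using bilinear_lzero[OF bilinear_g[OF \<psi> im]] by simp
    moreover have "eventually (\<lambda>s. ?h s = a s) (at t within ?I)"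
    proof -
      have "eventually (\<lambda>s. geo u s \<in> chart_dom \<psi>) (at t within ?I)"
        using eventually_in_chart_dom[OF \<psi> C1_curve_tendsto[OF geodesic_C1[OF geod] t]] d by (simp add: geo_F u t[simplified])
      then show ?thesis
        unfolding eventually_at_filter by eventually_elim (auto simp: a_local[OF _ \<psi>] geo_F u)
    qed
    ultimately have "(a has_real_derivative B u w) (at t within ?I)"
      using has_curve_deriv_transform[of ?h ?I t _ a] a_local[OF t \<psi> d]
      unfolding has_curve_deriv_real_iff by simp
    then show ?thesis by (auto intro!: derivative_eq_intros)
  qed
  then have "\<exists>k. \<forall>t\<in>?I. a t - t * B u w = k"
    by (intro has_field_derivative_zero_constant) auto
  then have "a 1 - 1 * B u w = a 0 - 0 * B u w"
    by (metis atLeastAtMost_iff order_refl zero_le_one)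
  moreover have "a 0 = 0"
  proof -
    obtain \<psi> where \<psi>: "\<psi> \<in> A" and d: "F (0 *\<^sub>R u) \<in> chart_dom \<psi>" by (rule chart_at)
    have "f \<psi> (0 *\<^sub>R u) \<in> chart_im \<psi>" using coord_in_chart_im[OF \<psi> d] by simp
    from bilinear_rzero[OF bilinear_g[OF \<psi> this]] show ?thesis
      using a_local[OF _ \<psi> d] by simp
  qed
  moreover have "a 1 = g \<psi> (f \<psi> u) (dir_deriv (f \<psi>) u u) (dir_deriv (f \<psi>) u w)"
    using a_local[of 1 \<psi>] \<psi> dom by simp
  ultimately show ?thesis by simp
qed

end

context exponential_chart
begin

section \<open>The distance function\<close>

definition radius :: "'m \<Rightarrow> real" where "radius y = sqrt (B (V y) (V y))"

lemma B_nonneg: "B u u \<ge> 0"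
  by (rule g_nonneg[OF chart(1) center_in_chart_im])

text \<open>Separation of points rests on this: positive definiteness at \<open>x\<close> gives
  \<open>V y = 0\<close>, and then \<open>y = F 0 = x\<close>.\<close>

lemma radius_eq_0_iff: "radius y = 0 \<longleftrightarrow> y = x"
proof
  assume "radius y = 0"
  then have "V y = 0"
    using g_pos[OF chart(1) center_in_chart_im, of "V y"] by (auto simp: radius_def)
  then show "y = x" using F_V[of y] F_0 by simp
next
  assume "y = x"
  then have "V y = 0" using V_F[OF zero_in_W] by (simp add: F_0)
  then show "radius y = 0"
    using bilinear_lzero[OF bilinear_g[OF chart(1) center_in_chart_im]] by (simp add: radius_def)
qed

text \<open>The velocity of \<open>c\<close> is the image of \<open>v'\<close> under the derivative
  of \<open>F\<close>. The Gauss lemma with \<open>w = v'\<close> writes \<open>B ?v v'\<close> as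
  the product of this velocity with \<open>?X\<close>, and with \<open>w = ?v\<close> it shows that
  \<open>?X\<close> has norm \<open>radius (c t)\<close>; Cauchy-Schwarz at \<open>c t\<close> gives
  the bound.\<close>

lemma radius_sq_deriv:
  assumes c: "C1_curve_on A S c" "t \<in> S" and S: "at t within S \<noteq> bot"
  shows "\<exists>D. ((\<lambda>s. B (V (c s)) (V (c s))) has_real_derivative D) (at t within S) \<and>
    \<bar>D\<bar> \<le> 2 * radius (c t) * riem_norm \<gamma> (c t) (velocity A S c t)"
proof -
  obtain \<psi> where \<psi>: "\<psi> \<in> A" and d: "c t \<in> chart_dom \<psi>" by (rule chart_at)
  let ?v = "V (c t)" and ?k = "velocity A S c t"
  let ?X = "dir_deriv (f \<psi>) ?v ?v"
  obtain v' where v': "has_curve_deriv (\<lambda>s. V (c s)) S t v'"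
    using V_curve_deriv[OF c \<psi> d] by blast
  have k: "?k \<psi> = dir_deriv (f \<psi>) ?v v'"
  proof (rule has_curve_deriv_unique)
    have "has_curve_deriv (\<lambda>s. f \<psi> (V (c s))) S t (dir_deriv (f \<psi>) ?v v')"
      using V_in_W F_V d by (intro C1_on_chain[OF C1_on_F[OF \<psi>] _ v']) simp
    then show "has_curve_deriv (\<lambda>s. coord \<psi> (c s)) S t (dir_deriv (f \<psi>) ?v v')"
      by (simp add: F_V)
    show "has_curve_deriv (\<lambda>s. coord \<psi> (c s)) S t (?k \<psi>)" by (rule C1_curve_has_deriv[OF c \<psi> d])
  qed (rule S)
  have im: "f \<psi> ?v \<in> chart_im \<psi>" using coord_in_chart_im[OF \<psi> d] by (simp add: F_V)
  have Gauss: "g \<psi> (f \<psi> ?v) ?X (dir_deriv (f \<psi>) ?v w) = B ?v w" for w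
    using V_in_W F_V d by (intro Gauss_lemma \<psi>) auto
  have norm: "riem_norm \<gamma> (c t) ?k = sqrt (g \<psi> (f \<psi> ?v) (?k \<psi>) (?k \<psi>))"
    using velocity_in_tangent_space[OF c S] metric_local[OF _ _ \<psi> d] by (simp add: riem_norm_def F_V)
  have "\<bar>B ?v v'\<bar> \<le> radius (c t) * riem_norm \<gamma> (c t) ?k"
    using g_Cauchy_Schwarz[OF \<psi> im, of ?X "?k \<psi>"] by (simp only: k Gauss norm radius_def)
  moreover have "((\<lambda>s. B (V (c s)) (V (c s))) has_real_derivative
     (dir_deriv (\<lambda>p. g \<phi> p ?v ?v) (coord \<phi> x) 0 + B v' ?v + B ?v v')) (at t within S)"
    by (intro has_derivative_g[OF chart(1) center_in_chart_im has_curve_deriv_const v' v'])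
  then have "((\<lambda>s. B (V (c s)) (V (c s))) has_real_derivative 2 * B ?v v') (at t within S)"
    using g_sym[OF chart(1) center_in_chart_im, of v' ?v] by (simp add: dir_deriv_zero)
  ultimately show ?thesis by (intro exI[of _ "2 * B ?v v'"]) (auto simp: abs_mult)
qed

text \<open>The radius need not be differentiable at the center, hence the shift by \<open>e\<close>.\<close>

lemma radius_lipschitz_C1:
  assumes c: "C1_curve_on A {a..b} c" and ab: "a < b"
  shows "\<bar>radius (c b) - radius (c a)\<bar> \<le> integral {a..b} (\<lambda>s. riem_norm \<gamma> (c s) (velocity A {a..b} c s))"
proof -
  let ?S = "{a..b}" and ?n = "\<lambda>s. riem_norm \<gamma> (c s) (velocity A {a..b} c s)"
  let ?R = "\<lambda>s. B (V (c s)) (V (c s))"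
  have S: "at t within ?S \<noteq> bot" if "t \<in> ?S" for t
    using that ab by (simp add: trivial_limit_within islimpt_Icc)
  have n_int: "?n integrable_on ?S"
    by (intro integrable_continuous_real continuous_on_speed c S)
  have ex: "\<forall>t\<in>?S. \<exists>D. (?R has_real_derivative D) (at t within ?S) \<and> \<bar>D\<bar> \<le> 2 * radius (c t) * ?n t"
    using radius_sq_deriv[OF c _ S] by blast
  obtain D where D: "\<And>t. t \<in> ?S \<Longrightarrow> (?R has_real_derivative D t) (at t within ?S)"
    "\<And>t. t \<in> ?S \<Longrightarrow> \<bar>D t\<bar> \<le> 2 * radius (c t) * ?n t"
    using bchoice[OF ex] by blast
  have bound: "\<bar>sqrt (?R b + e) - sqrt (?R a + e)\<bar> \<le> integral ?S ?n" if e: "e > 0" for e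
  proof -
    let ?h = "\<lambda>s. sqrt (?R s + e)" and ?h' = "\<lambda>s. D s / (2 * sqrt (?R s + e))"
    have pos: "?R s + e > 0" for s using B_nonneg[of "V (c s)"] e by linarith
    have "(?h has_real_derivative ?h' t) (at t within ?S)" if "t \<in> ?S" for t
      using D(1)[OF that] pos[of t]
      by (auto intro!: derivative_eq_intros simp: divide_simps)
    then have h: "(?h' has_integral (?h b - ?h a)) ?S"
      using ab by (intro fundamental_theorem_of_calculus)
        (auto simp: has_real_derivative_iff_has_vector_derivative)
    have "norm (?h' t) \<le> ?n t" if "t \<in> ?S" for t
    proof -
      have n0: "?n t \<ge> 0"
      proof -
        obtain \<psi> where \<psi>: "\<psi> \<in> A" and d: "c t \<in> chart_dom \<psi>" by (rule chart_at)
        show ?thesis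
          using metric_local[OF velocity_in_tangent_space[OF c that S[OF that]] velocity_in_tangent_space[OF c that S[OF that]] \<psi> d]
            g_nonneg[OF \<psi> coord_in_chart_im[OF \<psi> d]] by (simp add: riem_norm_def)
      qed
      have "\<bar>D t\<bar> \<le> 2 * radius (c t) * ?n t" by (rule D(2)[OF that])
      \<comment> \<open>Enlarging the radius to the shifted one cancels the denominator of
        \<open>?h'\<close>, so the bound is uniform in \<open>e\<close>.\<close>
      also have "\<dots> \<le> 2 * sqrt (?R t + e) * ?n t"
        using n0 e by (intro mult_right_mono) (auto simp: radius_def)
      finally show ?thesis
        using pos[of t] by (simp add: divide_simps mult.commute)
    qed
    then have "norm (integral ?S ?h') \<le> integral ?S ?n"
      using h n_int by (intro integral_norm_bound_integral) auto
    then show ?thesis using integral_unique[OF h] by simp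
  qed
  have "((\<lambda>e. \<bar>sqrt (?R b + e) - sqrt (?R a + e)\<bar>) \<longlongrightarrow> \<bar>sqrt (?R b + 0) - sqrt (?R a + 0)\<bar>) (at_right 0)"
    by (intro tendsto_intros)
  then have "\<bar>sqrt (?R b + 0) - sqrt (?R a + 0)\<bar> \<le> integral ?S ?n"
    by (rule tendsto_upperbound) (auto simp: eventually_at_filter bound)
  then show ?thesis by (simp add: radius_def)
qed

text \<open>The estimates for the C1 pieces are added. Velocities relative to the unit interval and
  to a piece agree in the interior of the piece, so the integrands differ at most at the two
  breakpoints.\<close>

lemma radius_lipschitz:
  assumes "piecewise_C1_path A \<eta>"
  shows "\<bar>radius (\<eta> 1) - radius (\<eta> 0)\<bar> \<le> path_length A \<gamma> \<eta>"
proof -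
  obtain n and \<tau> :: "nat \<Rightarrow> real" where \<tau>: "\<tau> 0 = 0" "\<tau> n = 1" "\<And>i. i < n \<Longrightarrow> \<tau> i < \<tau> (Suc i)"
    and C1: "\<And>i. i < n \<Longrightarrow> C1_curve_on A {\<tau> i..\<tau> (Suc i)} \<eta>"
    using assms unfolding piecewise_C1_path_def by blast
  have mono: "\<tau> i \<le> \<tau> j" if "i \<le> j" "j \<le> n" for i j
    using that
  proof (induction j rule: dec_induct)
    case (step k)
    then show ?case using \<tau>(3)[of k] by simp
  qed simp
  let ?N = "\<lambda>s. riem_norm \<gamma> (\<eta> s) (velocity A {0..1} \<eta> s)"
  \<comment> \<open>Integrability is carried through the induction because splitting the integral
    requires it.\<close>
  have "?N integrable_on {0..\<tau> i} \<and> \<bar>radius (\<eta> (\<tau> i)) - radius (\<eta> 0)\<bar> \<le> integral {0..\<tau> i} ?N" if "i \<le> n" for i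
    using that
  proof (induction i)
    case 0
    have "?N integrable_on {0}"
      using has_integral_refl(2)[of ?N "0::real"] by (rule has_integral_integrable)
    then show ?case by (simp add: \<tau>)
  next
    case (Suc i)
    let ?S = "{\<tau> i..\<tau> (Suc i)}"
    let ?M = "\<lambda>s. riem_norm \<gamma> (\<eta> s) (velocity A ?S \<eta> s)"
    have lt: "\<tau> i < \<tau> (Suc i)" using Suc.prems \<tau>(3) by simp
    have bnd: "0 \<le> \<tau> i" "\<tau> (Suc i) \<le> 1"
      using mono[of 0 i] mono[of "Suc i" n] Suc.prems \<tau> by auto
    have eq: "?N s = ?M s" if "s \<in> ?S - {\<tau> i, \<tau> (Suc i)}" for s
    proof -
      have "s \<in> interior ?S" "s \<in> interior {0..1}" using that bnd by auto
      then have "at s within {0..1} = at s within ?S" by (simp only: at_within_interior)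
      then have "velocity A {0..1} \<eta> s = velocity A ?S \<eta> s"
        unfolding velocity_def curve_deriv_def by (simp only:)
      then show ?thesis by simp
    qed
    have "at t within ?S \<noteq> bot" if "t \<in> ?S" for t
      using that lt by (simp add: trivial_limit_within islimpt_Icc)
    then have "?M integrable_on ?S"
      using Suc.prems by (intro integrable_continuous_real continuous_on_speed C1) auto
    then have int: "?N integrable_on ?S"
      by (rule integrable_spike_finite[of "{\<tau> i, \<tau> (Suc i)}", rotated 2]) (use eq in auto)
    have "integral ?S ?N = integral ?S ?M"
      by (rule Henstock_Kurzweil_Integration.integral_spike[of "{\<tau> i, \<tau> (Suc i)}"]) (use eq in auto)
    then have le: "\<bar>radius (\<eta> (\<tau> (Suc i))) - radius (\<eta> (\<tau> i))\<bar> \<le> integral ?S ?N"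
      using radius_lipschitz_C1[OF C1 lt] Suc.prems by simp
    have IH: "?N integrable_on {0..\<tau> i}" "\<bar>radius (\<eta> (\<tau> i)) - radius (\<eta> 0)\<bar> \<le> integral {0..\<tau> i} ?N"
      using Suc by auto
    have int': "?N integrable_on {0..\<tau> (Suc i)}"
      using Henstock_Kurzweil_Integration.integrable_combine[OF bnd(1) less_imp_le[OF lt] IH(1) int] .
    moreover have "integral {0..\<tau> i} ?N + integral ?S ?N = integral {0..\<tau> (Suc i)} ?N"
      by (rule Henstock_Kurzweil_Integration.integral_combine[OF bnd(1) less_imp_le[OF lt] int'])
    ultimately show ?case using le IH(2) by linarith
  qed
  from this[of n] show ?thesis by (simp add: \<tau> path_length_def)
qed

lemma radial_path:
  shows "piecewise_C1_path A (geo (V y))" and "geo (V y) 0 = x" and "geo (V y) 1 = y"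
    and "path_length A \<gamma> (geo (V y)) = radius y"
proof -
  note geod = geo_is_geodesic[OF V_in_W]
  show "piecewise_C1_path A (geo (V y))"
    unfolding piecewise_C1_path_def
    \<comment> \<open>A single piece: \<open>real\<close> sends the indices 0 and 1 to the
      breakpoints 0 and 1.\<close>
    by (rule exI[of _ 1], rule exI[of _ real]) (use geodesic_C1[OF geod] in auto)
  show "geo (V y) 0 = x" by (rule geo_0[OF V_in_W])
  show "geo (V y) 1 = y" using F_geo[OF V_in_W] F_V by metis
  have t: "tangent_of A \<phi> x (V y) \<in> tangent_space A x" by (rule tangent_of_in_tangent_space[OF chart])
  have "riem_norm \<gamma> (geo (V y) s) (velocity A {0..1} (geo (V y)) s) = radius y" if "s \<in> {0..1}" for s
    using geodesic_constant_speed[OF geod that] metric_local[OF t t chart]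
    by (simp add: riem_norm_def radius_def geo_0[OF V_in_W] geo_velocity_0[OF V_in_W] tangent_of_self[OF chart])
  then have "path_length A \<gamma> (geo (V y)) = integral {0..1} (\<lambda>_::real. radius y)"
    unfolding path_length_def by (rule integral_cong)
  then show "path_length A \<gamma> (geo (V y)) = radius y" by simp
qed

lemma riem_dist_eq_radius: "riem_dist A \<gamma> x y = ennreal (radius y)"
proof (rule antisym)
  show "riem_dist A \<gamma> x y \<le> ennreal (radius y)"
    unfolding riem_dist_def using radial_path[of y] by (intro INF_lower2[of "geo (V y)"]) auto
  have "radius x = 0" by (simp add: radius_eq_0_iff)
  then show "ennreal (radius y) \<le> riem_dist A \<gamma> x y"
    unfolding riem_dist_def using radius_lipschitz
    by (intro INF_greatest ennreal_leI) fastforce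
qed

text \<open>Collects what the final argument uses at \<open>x\<close>, freed from \<open>U\<close>
  and \<open>\<phi>\<close>, which have to be chosen anew for each point.\<close>

lemma distance_function:
  "\<exists>r. (\<forall>y. riem_dist A \<gamma> x y = ennreal (r y)) \<and> (\<forall>y. 0 \<le> r y) \<and> (\<forall>y. r y = 0 \<longleftrightarrow> y = x) \<and>
    (\<forall>\<eta>. piecewise_C1_path A \<eta> \<longrightarrow> \<bar>r (\<eta> 1) - r (\<eta> 0)\<bar> \<le> path_length A \<gamma> \<eta>) \<and>
    (\<forall>y. \<exists>\<eta>. piecewise_C1_path A \<eta> \<and> \<eta> 0 = x \<and> \<eta> 1 = y \<and> path_length A \<gamma> \<eta> = r y)"
proof (intro exI[of _ radius] conjI allI impI)
  show "riem_dist A \<gamma> x y = ennreal (radius y)" for y by (rule riem_dist_eq_radius)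
  show "0 \<le> radius y" for y by (simp add: radius_def B_nonneg)
  show "radius y = 0 \<longleftrightarrow> y = x" for y by (rule radius_eq_0_iff)
  show "\<bar>radius (\<eta> 1) - radius (\<eta> 0)\<bar> \<le> path_length A \<gamma> \<eta>" if "piecewise_C1_path A \<eta>" for \<eta>
    using that by (rule radius_lipschitz)
  show "\<exists>\<eta>. piecewise_C1_path A \<eta> \<and> \<eta> 0 = x \<and> \<eta> 1 = y \<and> path_length A \<gamma> \<eta> = radius y" for y
    using radial_path[of y] by blast
qed

end

text \<open>Finiteness is stated separately because \<open>enn2real\<close> sends infinity to 0 and
  could conceal it.\<close>

theorem theorem10:
  fixes A :: "('m::t2_space, 'e::frechet_space) chart set"
    and \<gamma> :: "('m, 'e) tensor2"
    and \<Gamma> :: "('m, 'e) christoffel"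
  assumes "smooth_atlas A"
    and "weak_riemannian_metric A \<gamma>"
    and "levi_civita A \<gamma> \<Gamma>"
    and "\<And>x. \<exists>U. (\<lambda>_. 0) \<in> U \<and> U \<subseteq> exp_domain A \<Gamma> x \<and> tangent_diffeo A x U (exp_map A \<Gamma> x)"
  shows "(\<forall>x y. riem_dist A \<gamma> x y < \<infinity>) \<and>
    Metric_space UNIV (\<lambda>x y. enn2real (riem_dist A \<gamma> x y))"
proof -
  interpret riemannian_manifold A \<gamma> \<Gamma>
    using assms by unfold_locales (auto simp: weak_riemannian_metric_def)
  have "\<forall>x. \<exists>r. (\<forall>y. riem_dist A \<gamma> x y = ennreal (r y)) \<and> (\<forall>y. 0 \<le> r y) \<and> (\<forall>y. r y = 0 \<longleftrightarrow> y = x) \<and>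
    (\<forall>\<eta>. piecewise_C1_path A \<eta> \<longrightarrow> \<bar>r (\<eta> 1) - r (\<eta> 0)\<bar> \<le> path_length A \<gamma> \<eta>) \<and>
    (\<forall>y. \<exists>\<eta>. piecewise_C1_path A \<eta> \<and> \<eta> 0 = x \<and> \<eta> 1 = y \<and> path_length A \<gamma> \<eta> = r y)"
  proof
    fix x
    obtain U where U: "(\<lambda>_. 0) \<in> U" "U \<subseteq> exp_domain A \<Gamma> x" "tangent_diffeo A x U (exp_map A \<Gamma> x)"
      using assms(4) by blast
    obtain \<phi> where "\<phi> \<in> A" "x \<in> chart_dom \<phi>" by (rule chart_at)
    with U interpret exponential_chart A \<gamma> \<Gamma> x U \<phi>
      by unfold_locales
    show "\<exists>r. (\<forall>y. riem_dist A \<gamma> x y = ennreal (r y)) \<and> (\<forall>y. 0 \<le> r y) \<and> (\<forall>y. r y = 0 \<longleftrightarrow> y = x) \<and>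
      (\<forall>\<eta>. piecewise_C1_path A \<eta> \<longrightarrow> \<bar>r (\<eta> 1) - r (\<eta> 0)\<bar> \<le> path_length A \<gamma> \<eta>) \<and>
      (\<forall>y. \<exists>\<eta>. piecewise_C1_path A \<eta> \<and> \<eta> 0 = x \<and> \<eta> 1 = y \<and> path_length A \<gamma> \<eta> = r y)"
      by (rule distance_function)
  qed
  then obtain r where dist: "\<And>x y. riem_dist A \<gamma> x y = ennreal (r x y)"
    and nonneg: "\<And>x y. 0 \<le> r x y" and zero: "\<And>x y. r x y = 0 \<longleftrightarrow> y = x"
    and lip: "\<And>x \<eta>. piecewise_C1_path A \<eta> \<Longrightarrow> \<bar>r x (\<eta> 1) - r x (\<eta> 0)\<bar> \<le> path_length A \<gamma> \<eta>"
    and attained: "\<And>x y. \<exists>\<eta>. piecewise_C1_path A \<eta> \<and> \<eta> 0 = x \<and> \<eta> 1 = y \<and> path_length A \<gamma> \<eta> = r x y"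
    by metis
  \<comment> \<open>A path from \<open>y\<close> to \<open>z\<close> of length exactly
    \<open>r y z\<close> is inserted into the Lipschitz estimate for \<open>r x\<close>. The case
    \<open>z = x\<close> gives one half of symmetry, the general case the triangle
    inequality.\<close>
  have diff: "\<bar>r x z - r x y\<bar> \<le> r y z" for x y z
    using attained[of y z] lip[of _ x] by metis
  have le: "r x y \<le> r y x" for x y
  proof -
    have "r x x = 0" by (simp add: zero)
    then show ?thesis using diff[of x x y] by linarith
  qed
  have "Metric_space UNIV r"
  proof
    show "r x y = r y x" for x y using le[of x y] le[of y x] by (rule antisym)
    show "r x z \<le> r x y + r y z" for x y z using diff[of x z y] by linarith
    show "r x y = 0 \<longleftrightarrow> x = y" for x y by (auto simp: zero)
  qed (rule nonneg)
  then show ?thesis by (simp add: dist nonneg)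
qed

end
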